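(* Let $A$ be a finitely generated monoid (with identity and absorbing element), let $\mathrm{H}_A$ be the Hall algebra of finite $A$-modules, and let $$\mathcal{J}^{\alpha}=\operatorname{span}\{\delta_{\overline M} : M \text{ is not of type } \alpha\}\subset \mathrm{H}_A.$$ Then $\mathcal{J}^\alpha\subset\mathrm{H}_A$ is a Hopf ideal.
   Context: A monoid $A$ is an associative semigroup with identity $1$ and absorbing element $0$ (not necessarily commutative). An $A$-module is a pointed set $(M,0_M)$ with an action $A\times M\to M$ satisfying $(ab)m=a(bm)$, $1m=m$, $0m=0_M$, $a0_M=0_M$; morphisms are pointed equivariant maps; submodules are pointed subsets preserved by $A$. All modules are finite sets, and $\dim M=|M|-1$. $M\oplus N$ is the wedge (disjoint union with basepoints identified); for a submodule $N\subset M$, $M/N$ is $M$ with all elements of $N$ identified with the basepoint. $\overline M$ is the isomorphism class of $M$, and $\delta_{\overline M}$ is the function on isomorphism classes that is $1$ on $\overline M$ and $0$ elsewhere. $M$ is of type $\alpha$ if for all $a\in A$ and $m_1,m_2\in M$: $am_1=am_2\neq0_M$ implies $m_1=m_2$. The Hall algebra $\mathrm{H}_A$ is the $\mathbb{Q}$-vector space of finitely supported functions from isomorphism classes of finite $A$-modules to $\mathbb{Q}$, with product $(f\star g)(\overline M)=\sum_{N\subset M}f(\overline{M/N})\,g(\overline N)$ (sum over all submodules $N\subset M$), unit $\delta_{\overline{0}}$, coproduct $\Delta(f)(\overline M,\overline N)=f(\overline{M\oplus N})$, counit $f\mapsto f(\overline 0)$, and grading $\deg\delta_{\overline M}=\dim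 M$. It is a graded, connected, co-commutative bialgebra, hence a Hopf algebra. *)

theory Defs
  imports Complex_Main "HOL-Library.Function_Algebras"
begin

section \<open>Modules over a monoid with absorbing element\<close>

text \<open>
  A monoid with absorbing element is a type of sort \<open>{monoid_mult, mult_zero}\<close>; no
  commutativity is assumed. The submonoid generated by a set contains both \<open>1\<close> and \<open>0\<close>.
\<close>

inductive_set monoid_gen :: "'a::{monoid_mult,mult_zero} set \<Rightarrow> 'a set"
  for G :: "'a set" where
  zero: "0 \<in> monoid_gen G"
| one: "1 \<in> monoid_gen G"
| incl: "g \<in> G \<Longrightarrow> g \<in> monoid_gen G"
| mult: "a \<in> monoid_gen G \<Longrightarrow> b \<in> monoid_gen G \<Longrightarrow> a * b \<in> monoid_gen G"

record ('a, 'm) amodule =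
  elems :: "'m set"
  base :: 'm
  act :: "'a \<Rightarrow> 'm \<Rightarrow> 'm"

definition fin_module :: "('a::{monoid_mult,mult_zero}, 'm) amodule \<Rightarrow> bool" where
  "fin_module M \<longleftrightarrow>
     finite (elems M) \<and> base M \<in> elems M \<and>
     (\<forall>a. \<forall>m\<in>elems M. act M a m \<in> elems M) \<and>
     (\<forall>a b. \<forall>m\<in>elems M. act M (a * b) m = act M a (act M b m)) \<and>
     (\<forall>m\<in>elems M. act M 1 m = m) \<and>
     (\<forall>m\<in>elems M. act M 0 m = base M) \<and>
     (\<forall>a. act M a (base M) = base M)"

definition module_hom :: "('a, 'm) amodule \<Rightarrow> ('a, 'n) amodule \<Rightarrow> ('m \<Rightarrow> 'n) \<Rightarrow> bool" where
  "module_hom M N \<phi> \<longleftrightarrow>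
     \<phi> ` elems M \<subseteq> elems N \<and> \<phi> (base M) = base N \<and>
     (\<forall>a. \<forall>m\<in>elems M. \<phi> (act M a m) = act N a (\<phi> m))"

definition module_iso :: "('a, 'm) amodule \<Rightarrow> ('a, 'n) amodule \<Rightarrow> bool" where
  "module_iso M N \<longleftrightarrow> (\<exists>\<phi>. module_hom M N \<phi> \<and> bij_betw \<phi> (elems M) (elems N))"

definition submodules :: "('a, 'm) amodule \<Rightarrow> 'm set set" where
  "submodules M = {N. N \<subseteq> elems M \<and> base M \<in> N \<and> (\<forall>a. \<forall>m\<in>N. act M a m \<in> N)}"

definition sub_module :: "('a, 'm) amodule \<Rightarrow> 'm set \<Rightarrow> ('a, 'm) amodule" where
  "sub_module M N = \<lparr>elems = N, base = base M, act = act M\<rparr>"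

definition quot_module :: "('a, 'm) amodule \<Rightarrow> 'm set \<Rightarrow> ('a, 'm) amodule" where
  "quot_module M N =
     \<lparr>elems = insert (base M) (elems M - N), base = base M,
      act = (\<lambda>a m. if act M a m \<in> N then base M else act M a m)\<rparr>"

text \<open>In the wedge the common basepoint is the left one.\<close>

definition wedge :: "('a, 'm) amodule \<Rightarrow> ('a, 'n) amodule \<Rightarrow> ('a, 'm + 'n) amodule" where
  "wedge M N =
     \<lparr>elems = Inl ` elems M \<union> Inr ` (elems N - {base N}), base = Inl (base M),
      act = (\<lambda>a x. case x of
               Inl m \<Rightarrow> Inl (act M a m)
             | Inr n \<Rightarrow> if act N a n = base N then Inl (base M) else Inr (act N a n))\<rparr>"

definition zero_module :: "('a, nat) amodule" where
  "zero_module = \<lparr>elems = {0}, base = 0, act = (\<lambda>_ _. 0)\<rparr>"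

definition type_alpha :: "('a, 'm) amodule \<Rightarrow> bool" where
  "type_alpha M \<longleftrightarrow>
     (\<forall>a. \<forall>m1\<in>elems M. \<forall>m2\<in>elems M.
        act M a m1 = act M a m2 \<and> act M a m1 \<noteq> base M \<longrightarrow> m1 = m2)"


section \<open>Isomorphism classes\<close>

text \<open>
  Every finite module is isomorphic to one whose elements are natural numbers, so an
  isomorphism class is represented by the set of its members of this kind. The class
  \<open>mod_class M\<close> is defined for finite modules \<open>M\<close> over an arbitrary element type.
\<close>

typedef (overloaded) 'a::"{monoid_mult,mult_zero}" iso_class =
  "{{P :: ('a, nat) amodule. fin_module P \<and> module_iso M P} | M :: ('a, nat) amodule. fin_module M}"
proof -
  have "fin_module (zero_module :: ('a, nat) amodule)"
    by (simp add: fin_module_def zero_module_def)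
  then show ?thesis by blast
qed

definition mod_class :: "('a::{monoid_mult,mult_zero}, 'm) amodule \<Rightarrow> 'a iso_class" where
  "mod_class M = Abs_iso_class {P. fin_module P \<and> module_iso M P}"

definition class_rep :: "'a::{monoid_mult,mult_zero} iso_class \<Rightarrow> ('a, nat) amodule" where
  "class_rep X = (SOME M. M \<in> Rep_iso_class X)"

lemma module_iso_refl: "module_iso M M"
  unfolding module_iso_def module_hom_def by (rule exI[of _ id]) auto

lemma module_iso_trans:
  assumes "module_iso M N" "module_iso N P"
  shows "module_iso M P"
proof -
  obtain f where f: "module_hom M N f" "bij_betw f (elems M) (elems N)"
    using assms(1) by (auto simp: module_iso_def)
  obtain g where g: "module_hom N P g" "bij_betw g (elems N) (elems P)"
    using assms(2) by (auto simp: module_iso_def)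
  have "module_hom M P (g \<circ> f)"
    using f(1) g(1) by (auto simp: module_hom_def image_subset_iff)
  moreover have "bij_betw (g \<circ> f) (elems M) (elems P)"
    using f(2) g(2) by (rule bij_betw_trans)
  ultimately show ?thesis unfolding module_iso_def by blast
qed

lemma module_iso_sym:
  assumes "fin_module M" "module_iso M N"
  shows "module_iso N M"
proof -
  obtain f where f: "module_hom M N f" "bij_betw f (elems M) (elems N)"
    using assms(2) by (auto simp: module_iso_def)
  define g where "g = inv_into (elems M) f"
  have inj: "inj_on f (elems M)" and img: "f ` elems M = elems N"
    using f(2) by (auto simp: bij_betw_def)
  have gf: "g (f m) = m" if "m \<in> elems M" for m
    using inj that by (simp add: g_def)
  have bg: "bij_betw g (elems N) (elems M)"
    unfolding g_def using f(2) by (rule bij_betw_inv_into)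
  have "g (act N a n) = act M a (g n)" if "n \<in> elems N" for a n
  proof -
    obtain m where m: "m \<in> elems M" "n = f m" using img \<open>n \<in> elems N\<close> by auto
    have "act M a m \<in> elems M" using assms(1) m(1) by (auto simp: fin_module_def)
    then show ?thesis using f(1) m gf by (metis module_hom_def)
  qed
  moreover have "g (base N) = base M"
    using f(1) gf assms(1) by (metis module_hom_def fin_module_def)
  moreover have "g ` elems N \<subseteq> elems M" using bg by (simp add: bij_betw_def)
  ultimately have "module_hom N M g" by (simp add: module_hom_def)
  then show ?thesis using bg unfolding module_iso_def by blast
qed

lemma ex_nat_module:
  fixes M :: "('a::{monoid_mult,mult_zero}, 'm) amodule"
  assumes "fin_module M"
  shows "\<exists>P :: ('a, nat) amodule. fin_module P \<and> module_iso M P"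
proof -
  have "finite (elems M)" using assms by (simp add: fin_module_def)
  then obtain f :: "'m \<Rightarrow> nat" where inj: "inj_on f (elems M)"
    using finite_imp_inj_to_nat_seg by blast
  define g where "g = inv_into (elems M) f"
  have gf: "g (f m) = m" if "m \<in> elems M" for m
    using inj that by (simp add: g_def)
  define P where
    "P = \<lparr>elems = f ` elems M, base = f (base M), act = (\<lambda>a n. f (act M a (g n)))\<rparr>"
  have "fin_module P"
    using assms by (auto simp: fin_module_def P_def gf)
  moreover have "module_iso M P"
    unfolding module_iso_def
    by (rule exI[of _ f]) (use inj in \<open>auto simp: module_hom_def P_def gf bij_betw_def\<close>)
  ultimately show ?thesis by blast
qed

lemma Rep_mod_class:
  fixes M :: "('a::{monoid_mult,mult_zero}, 'm) amodule"
  assumes "fin_module M"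
  shows "Rep_iso_class (mod_class M) = {P. fin_module P \<and> module_iso M P}"
proof -
  obtain Q :: "('a, nat) amodule" where Q: "fin_module Q" "module_iso M Q"
    using ex_nat_module[OF assms] by blast
  have "{P :: ('a, nat) amodule. fin_module P \<and> module_iso M P} =
        {P. fin_module P \<and> module_iso Q P}"
    using module_iso_trans[OF Q(2)] module_iso_trans[OF module_iso_sym[OF assms Q(2)]] by blast
  then show ?thesis
    unfolding mod_class_def using Q(1) by (intro Abs_iso_class_inverse) auto
qed

lemma mod_class_eq_iff:
  assumes "fin_module M" "fin_module N"
  shows "mod_class M = mod_class N \<longleftrightarrow> module_iso M N"
proof
  assume eq: "mod_class M = mod_class N"
  obtain P where P: "P \<in> Rep_iso_class (mod_class M)"
    using ex_nat_module[OF assms(1)] Rep_mod_class[OF assms(1)] by blast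
  have "module_iso M P" using P unfolding Rep_mod_class[OF assms(1)] by simp
  moreover have "module_iso N P" using P unfolding eq Rep_mod_class[OF assms(2)] by simp
  ultimately show "module_iso M N"
    using assms module_iso_trans module_iso_sym by metis
next
  assume iso: "module_iso M N"
  have "Rep_iso_class (mod_class M) = Rep_iso_class (mod_class N)"
    unfolding Rep_mod_class[OF assms(1)] Rep_mod_class[OF assms(2)]
    using module_iso_trans[OF iso] module_iso_trans[OF module_iso_sym[OF assms(1) iso]] by blast
  then show "mod_class M = mod_class N" by (simp add: Rep_iso_class_inject)
qed

lemma class_rep:
  "fin_module (class_rep X)" "mod_class (class_rep X) = X"
proof -
  obtain M :: "('a, nat) amodule" where M: "fin_module M"
    and X: "Rep_iso_class X = {P. fin_module P \<and> module_iso M P}"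
    using Rep_iso_class[of X] by blast
  have "class_rep X \<in> Rep_iso_class X"
    unfolding class_rep_def by (rule someI[of _ M]) (simp add: X M module_iso_refl)
  then have r: "fin_module (class_rep X)" "module_iso M (class_rep X)" by (auto simp: X)
  have "mod_class (class_rep X) = mod_class M"
    using r M mod_class_eq_iff by metis
  also have "\<dots> = X"
    using X Rep_mod_class[OF M] by (simp add: Rep_iso_class_inject[symmetric])
  finally show "fin_module (class_rep X)" "mod_class (class_rep X) = X" using r(1) by auto
qed


section \<open>Hopf ideals in spaces of finitely supported functions\<close>

text \<open>
  The tensor square of the space of finitely supported functions on \<open>'x\<close> is the space of
  finitely supported functions on \<open>'x \<times> 'x\<close>, with \<open>(f \<otimes> g) (x, y) = f x * g y\<close>.
\<close>

definition supp :: "('x \<Rightarrow> rat) \<Rightarrow> 'x set" where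
  "supp f = {x. f x \<noteq> 0}"

definition fin_supp :: "('x \<Rightarrow> rat) set" where
  "fin_supp = {f. finite (supp f)}"

definition delta :: "'x \<Rightarrow> 'x \<Rightarrow> rat" where
  "delta x = (\<lambda>y. if y = x then 1 else 0)"

definition qscale :: "rat \<Rightarrow> ('x \<Rightarrow> rat) \<Rightarrow> 'x \<Rightarrow> rat" where
  "qscale c f = (\<lambda>x. c * f x)"

interpretation qfun: vector_space qscale
  by unfold_locales (auto simp: qscale_def algebra_simps)

definition tensor :: "('x \<Rightarrow> rat) \<Rightarrow> ('x \<Rightarrow> rat) \<Rightarrow> 'x \<times> 'x \<Rightarrow> rat" where
  "tensor f g = (\<lambda>(x, y). f x * g y)"

definition tensor_space :: "('x \<Rightarrow> rat) set \<Rightarrow> ('x \<Rightarrow> rat) set \<Rightarrow> ('x \<times> 'x \<Rightarrow> rat) set" where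
  "tensor_space U V = qfun.span {tensor f g | f g. f \<in> U \<and> g \<in> V}"

text \<open>
  A linear map on the tensor square is determined by its values on
  \<open>delta x \<otimes> delta y\<close>; this is how the maps \<open>F \<otimes> G\<close> and the multiplication
  \<open>f \<otimes> g \<mapsto> f \<star> g\<close> are defined on it.
\<close>

definition tensor_map ::
  "(('x \<Rightarrow> rat) \<Rightarrow> 'x \<Rightarrow> rat) \<Rightarrow> (('x \<Rightarrow> rat) \<Rightarrow> 'x \<Rightarrow> rat) \<Rightarrow> ('x \<times> 'x \<Rightarrow> rat) \<Rightarrow> 'x \<times> 'x \<Rightarrow> rat" where
  "tensor_map F G t = (\<Sum>(x, y)\<in>supp t. qscale (t (x, y)) (tensor (F (delta x)) (G (delta y))))"

definition mult_map ::
  "(('x \<Rightarrow> rat) \<Rightarrow> ('x \<Rightarrow> rat) \<Rightarrow> 'x \<Rightarrow> rat) \<Rightarrow> ('x \<times> 'x \<Rightarrow> rat) \<Rightarrow> 'x \<Rightarrow> rat" where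
  "mult_map star t = (\<Sum>(x, y)\<in>supp t. qscale (t (x, y)) (star (delta x) (delta y)))"

definition is_antipode ::
  "(('x \<Rightarrow> rat) \<Rightarrow> ('x \<Rightarrow> rat) \<Rightarrow> 'x \<Rightarrow> rat) \<Rightarrow> ('x \<Rightarrow> rat) \<Rightarrow>
   (('x \<Rightarrow> rat) \<Rightarrow> 'x \<times> 'x \<Rightarrow> rat) \<Rightarrow> (('x \<Rightarrow> rat) \<Rightarrow> rat) \<Rightarrow>
   (('x \<Rightarrow> rat) \<Rightarrow> 'x \<Rightarrow> rat) \<Rightarrow> bool" where
  "is_antipode star unit cop counit S \<longleftrightarrow>
     S ` fin_supp \<subseteq> fin_supp \<and>
     (\<forall>f\<in>fin_supp. \<forall>g\<in>fin_supp. S (f + g) = S f + S g) \<and>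
     (\<forall>c. \<forall>f\<in>fin_supp. S (qscale c f) = qscale c (S f)) \<and>
     (\<forall>f\<in>fin_supp.
        mult_map star (tensor_map S id (cop f)) = qscale (counit f) unit \<and>
        mult_map star (tensor_map id S (cop f)) = qscale (counit f) unit)"

text \<open>
  An antipode is the convolution inverse of the identity, hence unique on \<open>fin_supp\<close> in a
  bialgebra; the existential quantifier below therefore refers to the antipode (and asserts
  that there is one).
\<close>

definition hopf_ideal ::
  "(('x \<Rightarrow> rat) \<Rightarrow> ('x \<Rightarrow> rat) \<Rightarrow> 'x \<Rightarrow> rat) \<Rightarrow> ('x \<Rightarrow> rat) \<Rightarrow>
   (('x \<Rightarrow> rat) \<Rightarrow> 'x \<times> 'x \<Rightarrow> rat) \<Rightarrow> (('x \<Rightarrow> rat) \<Rightarrow> rat) \<Rightarrow>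
   ('x \<Rightarrow> rat) set \<Rightarrow> bool" where
  "hopf_ideal star unit cop counit J \<longleftrightarrow>
     qfun.subspace J \<and> J \<subseteq> fin_supp \<and>
     (\<forall>f\<in>fin_supp. \<forall>j\<in>J. star f j \<in> J \<and> star j f \<in> J) \<and>
     (\<forall>j\<in>J. cop j \<in> {u + v | u v. u \<in> tensor_space J fin_supp \<and> v \<in> tensor_space fin_supp J}) \<and>
     (\<forall>j\<in>J. counit j = 0) \<and>
     (\<exists>S. is_antipode star unit cop counit S \<and> S ` J \<subseteq> J)"


section \<open>The Hall algebra\<close>

text \<open>
  The underlying space of the Hall algebra is \<open>fin_supp :: ('a iso_class \<Rightarrow> rat) set\<close>.
\<close>

definition hall_mult ::
  "('a::{monoid_mult,mult_zero} iso_class \<Rightarrow> rat) \<Rightarrow> ('a iso_class \<Rightarrow> rat) \<Rightarrow> 'a iso_class \<Rightarrow> rat" where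
  "hall_mult f g X =
     (let M = class_rep X in
      \<Sum>N\<in>submodules M. f (mod_class (quot_module M N)) * g (mod_class (sub_module M N)))"

definition hall_unit :: "'a::{monoid_mult,mult_zero} iso_class \<Rightarrow> rat" where
  "hall_unit = delta (mod_class zero_module)"

definition hall_comult ::
  "('a::{monoid_mult,mult_zero} iso_class \<Rightarrow> rat) \<Rightarrow> 'a iso_class \<times> 'a iso_class \<Rightarrow> rat" where
  "hall_comult f = (\<lambda>(X, Y). f (mod_class (wedge (class_rep X) (class_rep Y))))"

definition hall_counit :: "('a::{monoid_mult,mult_zero} iso_class \<Rightarrow> rat) \<Rightarrow> rat" where
  "hall_counit f = f (mod_class zero_module)"

definition J_alpha :: "('a::{monoid_mult,mult_zero} iso_class \<Rightarrow> rat) set" where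
  "J_alpha = qfun.span
     {delta (mod_class M) | M :: ('a, nat) amodule. fin_module M \<and> \<not> type_alpha M}"

end

theory Submission imports Defs begin

text \<open>
  A function lies in \<open>J_alpha\<close> iff it vanishes on all modules of type \<open>\<alpha>\<close>. Type \<open>\<alpha>\<close> is
  inherited by submodules, quotients and wedges, which gives the ideal and coideal properties;
  finite generation leaves finitely many classes in each dimension, so that products stay
  finitely supported. The antipode is given explicitly by
  \<open>(S f)(M) = \<Sum> (-1)\<^sup>k f(\<Oplus>\<^sub>i N\<^sub>i / N\<^sub>i\<^sub>-\<^sub>1)\<close>, summed over all chains
  \<open>0 = N\<^sub>0 \<subset> \<dots> \<subset> N\<^sub>k = M\<close>. In \<open>S \<star> id\<close> one sums over the chains ending in \<open>M\<close> with
  arbitrary first member, and inserting or deleting \<open>0\<close> is a sign-reversing involution on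
  these; \<open>id \<star> S\<close> is treated likewise with \<open>M\<close> in place of \<open>0\<close>. Finally, \<open>S\<close> preserves
  \<open>J_alpha\<close> because the associated graded modules of a module of type \<open>\<alpha>\<close> are of type \<open>\<alpha>\<close>.
\<close>


section \<open>Isomorphisms and constructions on modules\<close>

lemma module_isoI:
  assumes "bij_betw \<phi> (elems M) (elems N)" "\<phi> (base M) = base N"
    and "\<And>a m. m \<in> elems M \<Longrightarrow> \<phi> (act M a m) = act N a (\<phi> m)"
  shows "module_iso M N"
  using assms unfolding module_iso_def module_hom_def bij_betw_def by blast

lemma module_iso_card: "module_iso M N \<Longrightarrow> card (elems M) = card (elems N)"
  unfolding module_iso_def using bij_betw_same_card by blast

lemma mod_class_eqI:
  "fin_module M \<Longrightarrow> fin_module N \<Longrightarrow> module_iso M N \<Longrightarrow> mod_class M = mod_class N"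
  by (simp add: mod_class_eq_iff)

lemma module_iso_class_rep:
  "fin_module M \<Longrightarrow> module_iso (class_rep (mod_class M)) M"
  by (metis class_rep mod_class_eq_iff)

lemma fin_module_zero: "fin_module zero_module"
  by (simp add: fin_module_def zero_module_def)

lemma fin_module_sub: "fin_module M \<Longrightarrow> N \<in> submodules M \<Longrightarrow> fin_module (sub_module M N)"
  unfolding fin_module_def submodules_def sub_module_def
  by (auto intro: finite_subset)

lemma fin_module_quot: "fin_module M \<Longrightarrow> N \<in> submodules M \<Longrightarrow> fin_module (quot_module M N)"
  unfolding fin_module_def submodules_def quot_module_def
  by auto

lemma act_closed: "fin_module M \<Longrightarrow> m \<in> elems M \<Longrightarrow> act M a m \<in> elems M"
  by (simp add: fin_module_def)

lemma act_base: "fin_module M \<Longrightarrow> act M a (base M) = base M"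
  by (simp add: fin_module_def)

lemma act_mult: "fin_module M \<Longrightarrow> m \<in> elems M \<Longrightarrow> act M (a * b) m = act M a (act M b m)"
  by (simp add: fin_module_def)

lemma fin_module_wedge:
  assumes "fin_module M" "fin_module N"
  shows "fin_module (wedge M N)"
proof -
  have base: "base M \<in> elems M" using assms(1) by (simp add: fin_module_def)
  note M = act_closed[OF assms(1)] act_base[OF assms(1)] act_mult[OF assms(1)]
  note N = act_closed[OF assms(2)] act_base[OF assms(2)] act_mult[OF assms(2)]
  have "finite (elems (wedge M N))" "base (wedge M N) \<in> elems (wedge M N)"
    using assms by (simp_all add: fin_module_def wedge_def)
  moreover have "act (wedge M N) a x \<in> elems (wedge M N)"
    and "act (wedge M N) (a * b) x = act (wedge M N) a (act (wedge M N) b x)"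
    and "act (wedge M N) 1 x = x" and "act (wedge M N) 0 x = base (wedge M N)"
    if "x \<in> elems (wedge M N)" for a b x
  proof -
    have 1: "act M 1 m = m" "act M 0 m = base M" if "m \<in> elems M" for m
      using that assms(1) by (auto simp: fin_module_def)
    have 2: "act N 1 m = m" "act N 0 m = base N" if "m \<in> elems N" for m
      using that assms(2) by (auto simp: fin_module_def)
    consider m where "x = Inl m" "m \<in> elems M"
      | n where "x = Inr n" "n \<in> elems N" "n \<noteq> base N"
      using \<open>x \<in> elems (wedge M N)\<close> by (auto simp: wedge_def)
    note cases = this
    show "act (wedge M N) a x \<in> elems (wedge M N)"
      using cases M N base by cases (auto simp: wedge_def)
    show "act (wedge M N) (a * b) x = act (wedge M N) a (act (wedge M N) b x)"
      using cases M N by cases (auto simp: wedge_def)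
    show "act (wedge M N) 1 x = x" "act (wedge M N) 0 x = base (wedge M N)"
      using cases 1 2 by (cases; simp add: wedge_def)+
  qed
  moreover have "act (wedge M N) a (base (wedge M N)) = base (wedge M N)" for a
    using M by (simp add: wedge_def)
  ultimately show ?thesis by (simp add: fin_module_def)
qed

lemma finite_submodules: "fin_module M \<Longrightarrow> finite (submodules M)"
  unfolding fin_module_def submodules_def
  by (rule finite_subset[of _ "Pow (elems M)"]) auto

text \<open>The basepoint is counted both in the quotient and in \<open>N\<close>, so the right-hand
  sum exceeds the left-hand side by one. This later bounds the support of a product.\<close>

lemma card_quot_module:
  assumes "fin_module M" "N \<in> submodules M"
  shows "card (elems M) < card (elems (quot_module M N)) + card N"
proof -
  have "finite N" and *: "finite (elems M)" "N \<subseteq> elems M" "base M \<in> N"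
    using assms by (auto simp: submodules_def fin_module_def intro: finite_subset)
  then have "card (elems (quot_module M N)) = Suc (card (elems M) - card N)"
    by (simp add: quot_module_def card_Diff_subset)
  then show ?thesis by linarith
qed

text \<open>Both summands embed into the wedge, which later bounds the support of a
  coproduct.\<close>

lemma card_le_wedge:
  assumes "fin_module M" "fin_module N"
  shows "card (elems M) \<le> card (elems (wedge M N))" "card (elems N) \<le> card (elems (wedge M N))"
proof -
  have fin: "finite (elems M)" "finite (elems N)" "base M \<in> elems M" "base N \<in> elems N"
    using assms by (auto simp: fin_module_def)
  have "card (elems (wedge M N)) =
      card (Inl ` elems M :: ('b + 'c) set) + card (Inr ` (elems N - {base N}) :: ('b + 'c) set)"
    unfolding wedge_def amodule.simps using fin by (intro card_Un_disjoint) auto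
  then have "card (elems (wedge M N)) = card (elems M) + (card (elems N) - 1)"
    using fin by (simp add: card_image)
  \<comment> \<open>The left summand has at least its basepoint, which compensates for the
    \<open>- 1\<close> on the right one.\<close>
  moreover have "0 < card (elems M)"
    using fin by (auto simp: card_gt_0_iff)
  ultimately show "card (elems M) \<le> card (elems (wedge M N))"
    and "card (elems N) \<le> card (elems (wedge M N))" by linarith+
qed

text \<open>This makes the coproduct independent of the representatives chosen by
  \<open>class_rep\<close>.\<close>

lemma module_iso_wedge:
  assumes fin: "fin_module M" "fin_module N"
    and iso: "module_iso M M'" "module_iso N N'"
  shows "module_iso (wedge M N) (wedge M' N')"
proof -
  obtain f where f: "module_hom M M' f" "bij_betw f (elems M) (elems M')"
    using iso(1) by (auto simp: module_iso_def)
  obtain g where g: "module_hom N N' g" "bij_betw g (elems N) (elems N')"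
    using iso(2) by (auto simp: module_iso_def)
  have b: "base M \<in> elems M" "base N \<in> elems N" "f (base M) = base M'" "g (base N) = base N'"
    using fin f g by (auto simp: fin_module_def module_hom_def)
  \<comment> \<open>The action on the wedge tests for the basepoint of \<open>N\<close>, so
    \<open>g\<close> has to reflect basepoints as well as preserve them; injectivity gives
    this.\<close>
  have g0: "g n = base N' \<longleftrightarrow> n = base N" if "n \<in> elems N" for n
    using that b g(2) by (metis bij_betw_def inj_on_def)
  have cl: "act N a n \<in> elems N" if "n \<in> elems N" for a n
    using that fin by (auto simp: fin_module_def)
  have eq: "f (act M a m) = act M' a (f m)" if "m \<in> elems M" for a m
    using that f by (auto simp: module_hom_def)
  have eq': "g (act N a m) = act N' a (g m)" if "m \<in> elems N" for a m
    using that g by (auto simp: module_hom_def)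
  have "g ` (elems N - {base N}) = g ` elems N - g ` {base N}"
    using g(2) b(2) by (intro inj_on_image_set_diff[of g "elems N"]) (auto simp: bij_betw_def)
  then have im: "f ` elems M = elems M'" "g ` (elems N - {base N}) = elems N' - {base N'}"
    using f(2) g(2) b(4) by (simp_all add: bij_betw_def)
  show ?thesis
  proof (rule module_isoI[of "map_sum f g"])
    have "inj_on (map_sum f g) (elems (wedge M N))"
      using f(2) g(2) unfolding bij_betw_def inj_on_def wedge_def by fastforce
    moreover have "map_sum f g ` elems (wedge M N) = elems (wedge M' N')"
      by (simp add: wedge_def image_Un image_image im(1)[symmetric] im(2)[symmetric])
    ultimately show "bij_betw (map_sum f g) (elems (wedge M N)) (elems (wedge M' N'))"
      by (simp add: bij_betw_def)
    show "map_sum f g (base (wedge M N)) = base (wedge M' N')"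
      by (simp add: wedge_def b)
    show "map_sum f g (act (wedge M N) a x) = act (wedge M' N') a (map_sum f g x)"
      if "x \<in> elems (wedge M N)" for a x
    proof -
      consider m where "x = Inl m" "m \<in> elems M" | n where "x = Inr n" "n \<in> elems N"
        using \<open>x \<in> elems (wedge M N)\<close> by (auto simp: wedge_def)
      then show ?thesis
      proof cases
        case 1
        then show ?thesis using eq by (simp add: wedge_def)
      next
        case 2
        then show ?thesis using eq'[of n a] g0[OF cl, of n a] b by (simp add: wedge_def)
      qed
    qed
  qed
qed

lemma mod_class_wedge_class_rep:
  assumes "fin_module M" "fin_module N"
  shows "mod_class (wedge (class_rep (mod_class M)) (class_rep (mod_class N)))
    = mod_class (wedge M N)"
  using assms
  by (intro mod_class_eqI fin_module_wedge module_iso_wedge module_iso_class_rep class_rep)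

lemma mod_class_eq_zero_iff:
  assumes "fin_module M"
  shows "mod_class M = mod_class zero_module \<longleftrightarrow> elems M = {base M}"
proof
  assume "mod_class M = mod_class zero_module"
  then have "card (elems M) = card (elems (zero_module :: ('a, nat) amodule))"
    using assms fin_module_zero mod_class_eq_iff module_iso_card by blast
  then have "card (elems M) = 1" by (simp add: zero_module_def)
  then show "elems M = {base M}"
    using assms by (auto simp: fin_module_def card_1_singleton_iff)
next
  assume e: "elems M = {base M}"
  have "module_iso M (zero_module :: ('a, nat) amodule)"
    by (rule module_isoI[of "\<lambda>_. 0"]) (auto simp: zero_module_def e bij_betw_def)
  then show "mod_class M = mod_class zero_module"
    using assms fin_module_zero mod_class_eqI by blast
qed


section \<open>Finiteness of the set of classes of bounded dimension\<close>

text \<open>Induction on \<open>monoid_gen\<close>: the module axioms prescribe how \<open>0\<close>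
  and \<open>1\<close> act, and a product acts as a composite.\<close>

lemma act_determined_by_generators:
  assumes "a \<in> monoid_gen G" "fin_module P" "fin_module Q" "elems P = elems Q" "base P = base Q"
    and "\<And>g m. g \<in> G \<Longrightarrow> m \<in> elems P \<Longrightarrow> act P g m = act Q g m"
  shows "\<forall>m\<in>elems P. act P a m = act Q a m"
  using assms(1)
proof (induction rule: monoid_gen.induct)
  case (mult a b)
  then show ?case using assms(2-5) unfolding fin_module_def by metis
qed (use assms in \<open>auto simp: fin_module_def\<close>)

text \<open>Renumbering puts all classes of one cardinality on the same carrier, so that they differ
  only in basepoint and action.\<close>

lemma iso_class_initial_segment:
  fixes X :: "'a::{monoid_mult,mult_zero} iso_class"
  obtains P :: "('a, nat) amodule"
  where "fin_module P" "mod_class P = X" "elems P = {..<card (elems (class_rep X))}"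
proof -
  let ?M = "class_rep X"
  have M: "fin_module ?M" by (rule class_rep)
  then have "finite (elems ?M)" by (simp add: fin_module_def)
  then obtain f where f: "bij_betw f (elems ?M) {..<card (elems ?M)}"
    using ex_bij_betw_finite_nat lessThan_atLeast0 by metis
  define g where "g = inv_into (elems ?M) f"
  have gf: "g (f m) = m" if "m \<in> elems ?M" for m
    using f that by (simp add: g_def bij_betw_def)
  define P :: "('a, nat) amodule"
    where "P = \<lparr>elems = f ` elems ?M, base = f (base ?M), act = (\<lambda>a n. f (act ?M a (g n)))\<rparr>"
  have P: "fin_module P"
    using M by (auto simp: fin_module_def P_def gf)
  have "module_iso ?M P"
    by (rule module_isoI[of f]) (use f in \<open>auto simp: P_def gf bij_betw_def\<close>)
  then have "mod_class P = X"
    using mod_class_eqI[OF M P] class_rep(2) by metis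
  moreover have "elems P = {..<card (elems ?M)}"
    using f by (simp add: P_def bij_betw_def)
  ultimately show thesis using that P by blast
qed

text \<open>After renumbering, a class is determined by its cardinality, its basepoint and the
  action table of a finite generating set, and only finitely many such codes have bounded size. This
  is where finite generation enters.\<close>

lemma finite_classes_of_bounded_card:
  assumes "\<exists>G :: 'a::{monoid_mult,mult_zero} set. finite G \<and> monoid_gen G = UNIV"
  shows "finite {X :: 'a iso_class. card (elems (class_rep X)) \<le> n}" (is "finite ?S")
proof -
  obtain G :: "'a set" where G: "finite G" "monoid_gen G = UNIV" using assms by blast
  define P :: "'a iso_class \<Rightarrow> ('a, nat) amodule" where
    "P X = (SOME P. fin_module P \<and> mod_class P = X \<and> elems P = {..<card (elems (class_rep X))})" for X
  have P: "fin_module (P X)" "mod_class (P X) = X" "elems (P X) = {..<card (elems (class_rep X))}" for X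
  proof -
    have "\<exists>P. fin_module P \<and> mod_class P = X \<and> elems P = {..<card (elems (class_rep X))}"
      using iso_class_initial_segment[of X] by blast
    from someI_ex[OF this]
    show "fin_module (P X)" "mod_class (P X) = X" "elems (P X) = {..<card (elems (class_rep X))}"
      by (auto simp: P_def)
  qed
  \<comment> \<open>The default \<open>0\<close> off the table puts \<open>tab X\<close>, for
    \<open>X\<close> in \<open>?S\<close>, into the finite function set \<open>?F\<close>
    below.\<close>
  define tab :: "'a iso_class \<Rightarrow> 'a \<times> nat \<Rightarrow> nat" where
    "tab X = (\<lambda>(g, m). if g \<in> G \<and> m \<in> elems (P X) then act (P X) g m else 0)" for X
  define code where "code X = (card (elems (class_rep X)), base (P X), tab X)" for X
  let ?F = "{h. \<forall>x. (x \<in> G \<times> {..<n} \<longrightarrow> h x \<in> {..n}) \<and> (x \<notin> G \<times> {..<n} \<longrightarrow> h x = 0)}"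
  have cl: "act (P X) g m < card (elems (class_rep X))" if "m \<in> elems (P X)" for X g m
    using P(1)[of X] that P(3)[of X] by (auto simp: fin_module_def)
  have bs: "base (P X) < card (elems (class_rep X))" for X
    using P(1)[of X] P(3)[of X] by (auto simp: fin_module_def)
  have "code X \<in> {..n} \<times> {..n} \<times> ?F" if X: "X \<in> ?S" for X
  proof -
    have "tab X \<in> ?F"
      using X cl[of _ X] by (auto simp: tab_def P(3) intro: order.trans[OF less_imp_le])
    then show ?thesis using X bs[of X] by (auto simp: code_def)
  qed
  then have "code ` ?S \<subseteq> {..n} \<times> {..n} \<times> ?F" by blast
  moreover have "finite ({..n} \<times> {..n} \<times> ?F)"
    by (intro finite_cartesian_product finite_set_of_finite_funs G finite_lessThan finite_atMost)
  ultimately have "finite (code ` ?S)" by (rule finite_subset)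
  moreover have "inj_on code ?S"
  proof (rule inj_onI)
    fix X Y assume "code X = code Y"
    then have e: "elems (P X) = elems (P Y)" "base (P X) = base (P Y)" and t: "tab X = tab Y"
      by (auto simp: code_def P(3))
    have "act (P X) g m = act (P Y) g m" if "g \<in> G" "m \<in> elems (P X)" for g m
      using fun_cong[OF t, of "(g, m)"] that e by (simp add: tab_def)
    then have "\<forall>m\<in>elems (P X). act (P X) a m = act (P Y) a m" for a
      using act_determined_by_generators[of a G "P X" "P Y"] G(2) P(1) e by simp
    \<comment> \<open>The records may still differ off the carrier, hence an isomorphism instead of
      an equation.\<close>
    then have "module_iso (P X) (P Y)"
      by (intro module_isoI[of id]) (auto simp: e)
    then show "X = Y" using mod_class_eqI P(1,2) by metis
  qed
  ultimately show ?thesis by (rule finite_imageD)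
qed

lemma fin_supp_card_bound:
  fixes f :: "'a::{monoid_mult,mult_zero} iso_class \<Rightarrow> rat"
  assumes "f \<in> fin_supp"
  obtains n where "\<And>X. f X \<noteq> 0 \<Longrightarrow> card (elems (class_rep X)) \<le> n"
proof
  fix X assume "f X \<noteq> 0"
  then show "card (elems (class_rep X)) \<le> Max ((\<lambda>X. card (elems (class_rep X))) ` supp f)"
    using assms by (intro Max_ge) (auto simp: fin_supp_def supp_def)
qed

text \<open>Cardinality is an isomorphism invariant, so the bound on representatives passes to
  modules on any type. It is used on \<open>nat\<close> and, for wedges, on
  \<open>nat + nat\<close>.\<close>

lemma fin_supp_mod_class_bound:
  fixes f :: "'a::{monoid_mult,mult_zero} iso_class \<Rightarrow> rat"
  assumes "f \<in> fin_supp"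
  obtains n where
    "\<And>M :: ('a, 'm) amodule. fin_module M \<Longrightarrow> f (mod_class M) \<noteq> 0 \<Longrightarrow> card (elems M) \<le> n"
proof -
  obtain n where n: "\<And>X. f X \<noteq> 0 \<Longrightarrow> card (elems (class_rep X)) \<le> n"
    using fin_supp_card_bound[OF assms] by blast
  show thesis
  proof
    fix M :: "('a, 'm) amodule" assume "fin_module M" "f (mod_class M) \<noteq> 0"
    then show "card (elems M) \<le> n"
      using n[of "mod_class M"] module_iso_card[OF module_iso_class_rep[of M]] by simp
  qed
qed

lemma fin_suppI_card_bound:
  fixes f :: "'a::{monoid_mult,mult_zero} iso_class \<Rightarrow> rat"
  assumes "\<exists>G :: 'a set. finite G \<and> monoid_gen G = UNIV"
    and "\<And>X. f X \<noteq> 0 \<Longrightarrow> card (elems (class_rep X)) \<le> n"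
  shows "f \<in> fin_supp"
  using finite_subset[OF _ finite_classes_of_bounded_card[OF assms(1), of n], of "supp f"] assms(2)
  by (auto simp: fin_supp_def supp_def)


section \<open>Associated graded modules\<close>

text \<open>
  For a chain \<open>0 = N\<^sub>0 \<subset> \<dots> \<subset> N\<^sub>k = M\<close>, this is \<open>\<Oplus>\<^sub>i N\<^sub>i / N\<^sub>i\<^sub>-\<^sub>1\<close>, realised on
  the elements of \<open>M\<close>: an action step that drops to a smaller member of the chain is sent to
  the basepoint.
\<close>

definition graded :: "('a, 'm) amodule \<Rightarrow> 'm set set \<Rightarrow> ('a, 'm) amodule" where
  "graded M C =
     \<lparr>elems = elems M, base = base M,
      act = (\<lambda>a m. if \<exists>N\<in>C. m \<notin> N \<and> act M a m \<in> N then base M else act M a m)\<rparr>"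

text \<open>Only associativity is delicate: sending dropping steps to the basepoint has to be
  compatible with composing steps.\<close>

lemma fin_module_graded:
  assumes M: "fin_module M" and C: "C \<subseteq> submodules M"
  shows "fin_module (graded M C)"
proof -
  let ?drop = "\<lambda>a m. \<exists>N\<in>C. m \<notin> N \<and> act M a m \<in> N"
  let ?act = "act (graded M C)"
  have sub: "base M \<in> N" "act M a m \<in> N" if "N \<in> C" "m \<in> N" for N a m
    using that C by (auto simp: submodules_def)
  have act_drop: "?act a m = base M" if "?drop a m" for a m
    using that by (simp add: graded_def)
  have act_keep: "?act a m = act M a m" if "\<not> ?drop a m" for a m
    using that by (auto simp: graded_def)
  have act_graded_base: "?act a (base M) = base M" for a
    using act_base[OF M] by (simp add: graded_def)
  have mult: "?act (a * b) m = ?act a (?act b m)" if m: "m \<in> elems M" for a b m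
  proof -
    have ab: "act M (a * b) m = act M a (act M b m)"
      using M m by (auto simp: fin_module_def)
    \<comment> \<open>Members of \<open>C\<close> are closed under the action, so once a path has
      entered one it stays there. A composite step therefore enters a member exactly when one of its
      two steps does.\<close>
    have drop: "?drop (a * b) m \<longleftrightarrow> ?drop b m \<or> ?drop a (act M b m)"
      unfolding ab using sub(2) by metis
    show ?thesis
    proof (cases "?drop b m")
      case True
      then have "?drop (a * b) m" using drop by blast
      then show ?thesis using act_drop[OF True] act_drop act_graded_base by metis
    next
      case False
      then have "?drop (a * b) m \<longleftrightarrow> ?drop a (act M b m)" using drop by blast
      then show ?thesis
        using act_keep[OF False] act_drop act_keep ab by metis
    qed
  qed
  have closed: "?act a m \<in> elems M" if "m \<in> elems M" for a m
    using that M by (auto simp: graded_def fin_module_def)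
  have one: "?act 1 m = m" and zero: "?act 0 m = base M" if "m \<in> elems M" for m
    using that M by (auto simp: graded_def fin_module_def)
  have "elems (graded M C) = elems M" "base (graded M C) = base M"
    by (simp_all add: graded_def)
  then show ?thesis
    unfolding fin_module_def using M mult closed one zero act_graded_base
    by (simp add: fin_module_def)
qed

text \<open>A value of the graded action other than the basepoint is already the value of the action
  on \<open>M\<close>.\<close>

lemma type_alpha_graded:
  assumes "type_alpha M"
  shows "type_alpha (graded M C)"
proof -
  have eq: "elems (graded M C) = elems M" "base (graded M C) = base M"
    by (simp_all add: graded_def)
  have keep: "act (graded M C) a m = act M a m" if "act (graded M C) a m \<noteq> base M" for a m
    using that unfolding graded_def amodule.simps by metis
  show ?thesis
    using assms unfolding type_alpha_def eq by (metis keep)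
qed

text \<open>A step dropping into \<open>{base M}\<close> ends at the basepoint anyway.\<close>

lemma graded_insert_zero: "fin_module M \<Longrightarrow> graded M (insert {base M} C) = graded M C"
  unfolding graded_def by (auto simp: fun_eq_iff)

text \<open>No element of \<open>M\<close> lies outside \<open>elems M\<close>, so no further step
  drops. The actions may differ off the carrier, hence only an isomorphism.\<close>

lemma module_iso_graded_insert_elems: "module_iso (graded M (insert (elems M) C)) (graded M C)"
  by (rule module_isoI[of id]) (auto simp: graded_def)

text \<open>Common core of the two splittings below: once no step leads from outside
  \<open>N\<close> to a nonzero element of \<open>N\<close>, the module \<open>R\<close> falls apart
  into \<open>Q\<close> on the elements of \<open>M/N\<close> and \<open>P\<close> on
  \<open>N\<close>.\<close>

lemma module_iso_wedge_quot_sub: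
  assumes N: "N \<in> submodules M"
    and Q: "elems Q = elems (quot_module M N)" "base Q = base M"
    and P: "elems P = N" "base P = base M"
    and R: "elems R = elems M" "base R = base M"
    and actP: "\<And>a m. m \<in> N \<Longrightarrow> act R a m = act P a m \<and> act P a m \<in> N"
    and actP0: "\<And>a. act P a (base M) = base M"
    and actQ: "\<And>a m. m \<in> elems M - N \<Longrightarrow> act R a m = act Q a m \<and> act Q a m \<in> elems Q"
    and actQ0: "\<And>a. act Q a (base M) = base M"
  shows "module_iso R (wedge Q P)"
proof -
  \<comment> \<open>The basepoint goes to the left because the wedge keeps the left
    basepoint.\<close>
  define \<phi> where "\<phi> m = (if m \<in> N - {base M} then Inr m else Inl m)" for m
  have sub: "N \<subseteq> elems M" "base M \<in> N" using N by (auto simp: submodules_def)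
  show ?thesis
  proof (rule module_isoI[of \<phi>])
    have "inj_on \<phi> (elems R)" by (auto simp: inj_on_def \<phi>_def split: if_splits)
    moreover have "\<phi> ` elems R = elems (wedge Q P)"
      using sub by (auto simp: \<phi>_def wedge_def Q P R quot_module_def)
    ultimately show "bij_betw \<phi> (elems R) (elems (wedge Q P))"
      by (simp add: bij_betw_def)
    show "\<phi> (base R) = base (wedge Q P)"
      by (simp add: \<phi>_def wedge_def Q R)
    show "\<phi> (act R a m) = act (wedge Q P) a (\<phi> m)" if "m \<in> elems R" for a m
    proof (cases "m \<in> N")
      case True
      then show ?thesis
        using actP[OF True, of a] actP0[of a] actQ0[of a] by (auto simp: \<phi>_def wedge_def Q P)
    next
      case False
      then have "act R a m = act Q a m" "act Q a m \<in> elems Q"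
        using actQ[of m a] that R by auto
      then show ?thesis
        using False sub by (auto simp: \<phi>_def wedge_def Q P quot_module_def)
    qed
  qed
qed

text \<open>The member \<open>{base M}\<close> of \<open>C\<close> lifts to \<open>N\<close>, which
  cuts off the steps from outside into \<open>N\<close>. Every lifted member contains
  \<open>N\<close>, so nothing is dropped inside \<open>N\<close>.\<close>

lemma module_iso_graded_quot:
  assumes M: "fin_module M" and N: "N \<in> submodules M"
    and C: "C \<subseteq> submodules (quot_module M N)" "{base M} \<in> C"
  shows "module_iso (graded M ((\<lambda>D. D \<union> N) ` C)) (wedge (graded (quot_module M N) C) (sub_module M N))"
proof (rule module_iso_wedge_quot_sub[OF N])
  have Q: "fin_module (graded (quot_module M N) C)"
    using fin_module_graded[OF fin_module_quot[OF M N] C(1)] .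
  have sub: "N \<subseteq> elems M" "base M \<in> N" "act M a m \<in> N" if "m \<in> N" for a m
    using N that by (auto simp: submodules_def)
  have bC: "base M \<in> D" if "D \<in> C" for D
    using that C by (auto simp: submodules_def quot_module_def)
  show "act (graded M ((\<lambda>D. D \<union> N) ` C)) a m = act (sub_module M N) a m \<and> act (sub_module M N) a m \<in> N"
    if "m \<in> N" for a m
    using that sub by (auto simp: graded_def sub_module_def)
  show "act (sub_module M N) a (base M) = base M" for a
    using act_base[OF M] by (simp add: sub_module_def)
  show "act (graded (quot_module M N) C) a (base M) = base M" for a
    using act_base[OF M] by (simp add: graded_def quot_module_def)
  show "act (graded M ((\<lambda>D. D \<union> N) ` C)) a m = act (graded (quot_module M N) C) a m \<and>
      act (graded (quot_module M N) C) a m \<in> elems (graded (quot_module M N) C)"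
    if "m \<in> elems M - N" for a m
  proof
    show "act (graded (quot_module M N) C) a m \<in> elems (graded (quot_module M N) C)"
      using act_closed[OF Q, of m a] that by (simp add: graded_def quot_module_def)
    show "act (graded M ((\<lambda>D. D \<union> N) ` C)) a m = act (graded (quot_module M N) C) a m"
      using that C(2) bC N by (auto simp: graded_def quot_module_def submodules_def)
  qed
qed (auto simp: graded_def quot_module_def sub_module_def)

text \<open>Every member of \<open>C\<close> lies inside \<open>N\<close>, and \<open>N\<close> is
  one of them. So a step from outside drops exactly when it enters \<open>N\<close>, as in the
  quotient.\<close>

lemma module_iso_graded_sub:
  assumes M: "fin_module M" and N: "N \<in> submodules M"
    and C: "C \<subseteq> submodules (sub_module M N)" "N \<in> C"
  shows "module_iso (graded M C) (wedge (quot_module M N) (graded (sub_module M N) C))"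
proof (rule module_iso_wedge_quot_sub[OF N])
  have subC: "D \<subseteq> N" if "D \<in> C" for D
    using that C by (auto simp: submodules_def sub_module_def)
  have sub: "base M \<in> N" "\<And>a m. m \<in> N \<Longrightarrow> act M a m \<in> N"
    using N by (auto simp: submodules_def)
  show "act (graded (sub_module M N) C) a (base M) = base M" for a
    using act_base[OF M] by (simp add: graded_def sub_module_def)
  show "act (quot_module M N) a (base M) = base M" for a
    using act_base[OF M] by (simp add: quot_module_def)
  show "act (graded M C) a m = act (graded (sub_module M N) C) a m \<and>
      act (graded (sub_module M N) C) a m \<in> N" if "m \<in> N" for a m
    using that sub by (auto simp: graded_def sub_module_def)
  show "act (graded M C) a m = act (quot_module M N) a m \<and>
      act (quot_module M N) a m \<in> elems (quot_module M N)" if "m \<in> elems M - N" for a m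
    using that act_closed[OF M, of m a] subC C(2) by (auto simp: graded_def quot_module_def)
qed (auto simp: graded_def quot_module_def sub_module_def)


section \<open>Flags of submodules\<close>

definition submodule_chains :: "('a, 'm) amodule \<Rightarrow> 'm set set set" where
  "submodule_chains M = {C. C \<subseteq> submodules M \<and> (\<forall>D\<in>C. \<forall>E\<in>C. D \<subseteq> E \<or> E \<subseteq> D)}"

text \<open>A chain from \<open>N\<^sub>0\<close> to \<open>N\<^sub>k\<close> is encoded as the set
  of its \<open>k + 1\<close> members, so its sign \<open>(- 1) ^ k\<close> appears below as
  \<open>(- 1) ^ (card C + 1)\<close>.\<close>

definition flags :: "('a, 'm) amodule \<Rightarrow> 'm set set set" where
  "flags M = {C \<in> submodule_chains M. {base M} \<in> C \<and> elems M \<in> C}"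

lemma submodule_chains_subset: "C \<in> submodule_chains M \<Longrightarrow> C \<subseteq> submodules M"
  by (simp add: submodule_chains_def)

lemma flags_subset: "C \<in> flags M \<Longrightarrow> C \<subseteq> submodules M"
  by (simp add: flags_def submodule_chains_def)

lemma finite_submodule_chains: "fin_module M \<Longrightarrow> finite (submodule_chains M)"
  by (rule finite_subset[of _ "Pow (submodules M)"])
    (auto simp: submodule_chains_def finite_submodules)

lemma finite_chain: "fin_module M \<Longrightarrow> C \<in> submodule_chains M \<Longrightarrow> finite C"
  using finite_submodules finite_subset submodule_chains_subset by metis

text \<open>A minimal member exists by finiteness and is least by comparability. Thus
  \<open>\<Inter>C\<close> names the first member of a chain, and dually \<open>\<Union>C\<close>
  the last; chains are later grouped by these.\<close>

lemma Inter_mem_chain: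
  assumes "fin_module M" "C \<in> submodule_chains M" "C \<noteq> {}"
  shows "\<Inter>C \<in> C"
proof -
  obtain N where N: "N \<in> C" "\<And>D. D \<in> C \<Longrightarrow> D \<subseteq> N \<Longrightarrow> N = D"
    using finite_has_minimal[OF finite_chain[OF assms(1,2)] assms(3)] by blast
  have "N \<subseteq> D" if "D \<in> C" for D
  proof -
    have "N \<subseteq> D \<or> D \<subseteq> N" using that N(1) assms(2) by (simp add: submodule_chains_def)
    then show ?thesis using N(2)[OF that] by auto
  qed
  then have "\<Inter>C = N" using N(1) by blast
  then show ?thesis using N(1) by simp
qed

lemma Union_mem_chain:
  assumes "fin_module M" "C \<in> submodule_chains M" "C \<noteq> {}"
  shows "\<Union>C \<in> C"
proof -
  obtain N where N: "N \<in> C" "\<And>D. D \<in> C \<Longrightarrow> N \<subseteq> D \<Longrightarrow> N = D"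
    using finite_has_maximal[OF finite_chain[OF assms(1,2)] assms(3)] by blast
  have "D \<subseteq> N" if "D \<in> C" for D
  proof -
    have "N \<subseteq> D \<or> D \<subseteq> N" using that N(1) assms(2) by (simp add: submodule_chains_def)
    then show ?thesis using N(2)[OF that] by auto
  qed
  then have "\<Union>C = N" using N(1) by blast
  then show ?thesis using N(1) by simp
qed

lemma zero_submodule: "fin_module M \<Longrightarrow> {base M} \<in> submodules M"
  by (auto simp: submodules_def fin_module_def)

lemma elems_submodule: "fin_module M \<Longrightarrow> elems M \<in> submodules M"
  by (auto simp: submodules_def fin_module_def)

lemma submodules_sub_module:
  "N \<in> submodules M \<Longrightarrow> submodules (sub_module M N) = {D \<in> submodules M. D \<subseteq> N}"
  by (auto simp: submodules_def sub_module_def)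

text \<open>Submodules of \<open>N\<close> are themselves submodules of \<open>M\<close>, so this is
  an equality of sets, whereas flags of a quotient have to be lifted.\<close>

lemma flags_sub_module:
  assumes M: "fin_module M" and N: "N \<in> submodules M"
  shows "flags (sub_module M N) = {C \<in> submodule_chains M. {base M} \<in> C \<and> \<Union>C = N}"
proof -
  have "flags (sub_module M N) =
      {C \<in> submodule_chains M. {base M} \<in> C \<and> N \<in> C \<and> (\<forall>D\<in>C. D \<subseteq> N)}"
    unfolding flags_def submodule_chains_def submodules_sub_module[OF N]
    by (auto simp: sub_module_def)
  also have "\<dots> = {C \<in> submodule_chains M. {base M} \<in> C \<and> \<Union>C = N}"
    using Union_mem_chain[OF M] by blast
  finally show ?thesis .
qed

text \<open>The correspondence between submodules of \<open>M/N\<close> and submodules of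
  \<open>M\<close> containing \<open>N\<close>, applied memberwise to chains.\<close>

lemma bij_betw_flags_quot_module:
  assumes M: "fin_module M" and N: "N \<in> submodules M"
  shows "bij_betw (image (\<lambda>D. D \<union> N)) (flags (quot_module M N))
    {C \<in> submodule_chains M. elems M \<in> C \<and> \<Inter>C = N}"
    (is "bij_betw (image ?up) ?F ?G")
proof -
  \<comment> \<open>The quotient is realised on the complement of \<open>N\<close> with the
    basepoint put back.\<close>
  let ?down = "\<lambda>D. insert (base M) (D - N)"
  have sub: "N \<subseteq> elems M" "base M \<in> N" "\<And>a m. m \<in> N \<Longrightarrow> act M a m \<in> N"
    using N by (auto simp: submodules_def)
  have down_up: "?down (?up D) = D" if "D \<in> submodules (quot_module M N)" for D
    using that sub by (auto simp: submodules_def quot_module_def)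
  have up: "?up D \<in> submodules M" if "D \<in> submodules (quot_module M N)" for D
  proof -
    have D: "D \<subseteq> insert (base M) (elems M - N)"
      "\<And>a m. m \<in> D \<Longrightarrow> (if act M a m \<in> N then base M else act M a m) \<in> D"
      using that by (auto simp: submodules_def quot_module_def)
    have "act M a m \<in> D \<union> N" if "m \<in> D \<union> N" for a m
      using that D(2)[of m a] sub(3) by (auto split: if_splits)
    then show ?thesis using D(1) sub by (auto simp: submodules_def)
  qed
  have down: "?down D \<in> submodules (quot_module M N)" if "D \<in> submodules M" "N \<subseteq> D" for D
    using that M sub by (auto simp: submodules_def quot_module_def fin_module_def)
  have up_down: "?up (?down D) = D" if "N \<subseteq> D" for D
    using that sub by auto
  show ?thesis
  proof (rule bij_betw_byWitness[where f' = "image ?down"])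
    show "\<forall>C\<in>?F. image ?down (image ?up C) = C"
    proof
      fix C assume "C \<in> ?F"
      then have "\<forall>D\<in>C. ?down (?up D) = D" using down_up flags_subset by blast
      then show "image ?down (image ?up C) = C" by (simp add: image_image)
    qed
    show "\<forall>C\<in>?G. image ?up (image ?down C) = C"
    proof
      fix C assume "C \<in> ?G"
      then have "\<forall>D\<in>C. ?up (?down D) = D" using up_down by blast
      then show "image ?up (image ?down C) = C" by (simp add: image_image)
    qed
    show "image (image ?up) ?F \<subseteq> ?G"
    proof
      fix C' assume "C' \<in> image (image ?up) ?F"
      then obtain C where C: "C \<in> ?F" "C' = ?up ` C" by blast
      have b: "{base M} \<in> C" "insert (base M) (elems M - N) \<in> C"
        using C(1) by (auto simp: flags_def quot_module_def)
      \<comment> \<open>The two ends of a flag lift to \<open>N\<close> and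
        \<open>elems M\<close>.\<close>
      have "?up {base M} \<in> C'" "?up (insert (base M) (elems M - N)) \<in> C'"
        using b C(2) by blast+
      moreover have "?up {base M} = N" "?up (insert (base M) (elems M - N)) = elems M"
        using sub by auto
      ultimately have "N \<in> C'" "elems M \<in> C'" by auto
      moreover have "C' \<in> submodule_chains M"
        unfolding submodule_chains_def
      proof (intro CollectI conjI ballI)
        show "C' \<subseteq> submodules M" using C(2) up flags_subset[OF C(1)] by blast
        fix D E assume "D \<in> C'" "E \<in> C'"
        then obtain D' E' where "D' \<in> C" "E' \<in> C" "D = ?up D'" "E = ?up E'"
          using C(2) by blast
        moreover from this have "D' \<subseteq> E' \<or> E' \<subseteq> D'"
          using C(1) by (simp add: flags_def submodule_chains_def)
        ultimately show "D \<subseteq> E \<or> E \<subseteq> D" by blast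
      qed
      ultimately show "C' \<in> ?G" using C(2) by auto
    qed
    show "image (image ?down) ?G \<subseteq> ?F"
    proof
      fix C' assume "C' \<in> image (image ?down) ?G"
      then obtain C where C: "C \<in> ?G" "C' = ?down ` C" by blast
      \<comment> \<open>The least member \<open>N\<close> is what becomes the zero submodule of the
        quotient.\<close>
      have NC: "N \<in> C" using C(1) Inter_mem_chain[OF M, of C] by auto
      have le: "N \<subseteq> D" if "D \<in> C" for D using that C(1) by blast
      have "?down N \<in> C'" "?down (elems M) \<in> C'" using NC C by auto
      moreover have "C' \<subseteq> submodules (quot_module M N)"
        using C down le submodule_chains_subset[of C M] by blast
      moreover have "\<forall>D\<in>C'. \<forall>E\<in>C'. D \<subseteq> E \<or> E \<subseteq> D"
      proof (intro ballI)
        fix D E assume "D \<in> C'" "E \<in> C'"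
        then obtain D' E' where "D' \<in> C" "E' \<in> C" "D = ?down D'" "E = ?down E'"
          using C(2) by blast
        moreover from this have "D' \<subseteq> E' \<or> E' \<subseteq> D'" using C(1) by (simp add: submodule_chains_def)
        ultimately show "D \<subseteq> E \<or> E \<subseteq> D" by blast
      qed
      ultimately show "C' \<in> ?F" by (simp add: flags_def submodule_chains_def quot_module_def)
    qed
  qed
qed

text \<open>Toggling membership of \<open>x\<close> is an involution that preserves \<open>h\<close>
  and flips the sign, so the sum equals its own negative.\<close>

lemma sum_toggle_eq_0:
  fixes h :: "'x set \<Rightarrow> rat"
  assumes fin: "\<And>C. C \<in> \<C> \<Longrightarrow> finite C"
    and toggle: "\<And>C. C \<in> \<C> \<Longrightarrow> insert x C \<in> \<C> \<and> C - {x} \<in> \<C>"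
    and h: "\<And>C. C \<in> \<C> \<Longrightarrow> h (insert x C) = h C"
  shows "(\<Sum>C\<in>\<C>. (- 1) ^ (card C + 1) * h C) = 0"
proof -
  define \<tau> where "\<tau> C = (if x \<in> C then C - {x} else insert x C)" for C
  have \<tau>: "\<tau> (\<tau> C) = C" "C \<in> \<C> \<Longrightarrow> \<tau> C \<in> \<C>" for C
    using toggle[of C] by (auto simp: \<tau>_def insert_absorb)
  have "h (\<tau> C) = h C" if "C \<in> \<C>" for C
  proof (cases "x \<in> C")
    case True
    \<comment> \<open>The hypothesis on \<open>h\<close> speaks of insertion only; applied to
      \<open>C - {x}\<close> it also covers removal.\<close>
    then have "h C = h (C - {x})"
      using h[of "C - {x}"] toggle[OF that] by (simp only: insert_Diff)
    then show ?thesis using True by (simp add: \<tau>_def)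
  next
    case False
    then show ?thesis using h[OF that] by (simp add: \<tau>_def)
  qed
  moreover have "(- 1 :: rat) ^ (card (\<tau> C) + 1) = - ((- 1) ^ (card C + 1))" if "C \<in> \<C>" for C
  proof (cases "x \<in> C")
    case True
    then have "card C = Suc (card (\<tau> C))"
      using card.remove[OF fin[OF that], of x] by (simp only: \<tau>_def if_True)
    then show ?thesis by simp
  next
    case False
    then have "card (\<tau> C) = Suc (card C)"
      using fin[OF that] by (simp add: \<tau>_def)
    then show ?thesis by simp
  qed
  ultimately have "(\<Sum>C\<in>\<C>. (- 1) ^ (card (\<tau> C) + 1) * h (\<tau> C)) =
      - (\<Sum>C\<in>\<C>. (- 1) ^ (card C + 1) * h C)"
    unfolding sum_negf[symmetric] by (intro sum.cong refl) simp
  moreover have "bij_betw \<tau> \<C> \<C>"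
    by (rule bij_betw_byWitness[where f' = \<tau>]) (use \<tau> in auto)
  then have "(\<Sum>C\<in>\<C>. (- 1) ^ (card (\<tau> C) + 1) * h (\<tau> C)) = (\<Sum>C\<in>\<C>. (- 1) ^ (card C + 1) * h C)"
    by (rule sum.reindex_bij_betw)
  ultimately show ?thesis by simp
qed

text \<open>Lifting therefore preserves the cardinality of a flag, and with it the sign.\<close>

lemma inj_on_union_quot:
  assumes "N \<in> submodules M"
  shows "inj_on (\<lambda>D. D \<union> N) (submodules (quot_module M N))"
proof (rule inj_on_inverseI)
  show "insert (base M) ((D \<union> N) - N) = D" if "D \<in> submodules (quot_module M N)" for D
    using that assms by (auto simp: submodules_def quot_module_def)
qed

section \<open>Invariance of signed sums over flags under isomorphism\<close>

lemma module_iso_obtain_inverse: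
  assumes "fin_module M" "module_iso M N"
  obtains f g where "module_hom M N f" "module_hom N M g"
    "\<And>m. m \<in> elems M \<Longrightarrow> g (f m) = m" "\<And>n. n \<in> elems N \<Longrightarrow> f (g n) = n"
proof -
  obtain f where f: "module_hom M N f" "bij_betw f (elems M) (elems N)"
    using assms(2) by (auto simp: module_iso_def)
  define g where "g = inv_into (elems M) f"
  have gf: "g (f m) = m" if "m \<in> elems M" for m
    using f(2) that by (simp add: g_def bij_betw_def)
  have fg: "f (g n) = n" "g n \<in> elems M" if "n \<in> elems N" for n
    using f(2) that by (auto simp: g_def bij_betw_def f_inv_into_f inv_into_into)
  have "g (act N a n) = act M a (g n)" if "n \<in> elems N" for a n
  proof -
    have "act N a n = f (act M a (g n))"
      using f(1) fg[OF that] by (simp add: module_hom_def)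
    then show ?thesis using gf[OF act_closed[OF assms(1) fg(2)[OF that]]] by simp
  qed
  moreover have "g (base N) = base M"
    using f(1) gf[of "base M"] assms(1) by (simp add: module_hom_def fin_module_def)
  ultimately have "module_hom N M g"
    using fg(2) by (auto simp: module_hom_def)
  then show thesis using that f(1) gf fg(1) by blast
qed

lemma image_submodule:
  assumes "module_hom M M' f" "N \<in> submodules M"
  shows "f ` N \<in> submodules M'"
proof -
  have N: "N \<subseteq> elems M" "base M \<in> N" "\<And>a m. m \<in> N \<Longrightarrow> act M a m \<in> N"
    using assms(2) by (auto simp: submodules_def)
  have f: "f ` elems M \<subseteq> elems M'" "f (base M) = base M'"
    and eq: "\<And>a m. m \<in> elems M \<Longrightarrow> f (act M a m) = act M' a (f m)"
    using assms(1) by (auto simp: module_hom_def)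
  have "act M' a (f m) \<in> f ` N" if "m \<in> N" for a m
  proof -
    have "m \<in> elems M" using N(1) that by blast
    then show ?thesis using imageI[OF N(3)[OF that, of a], of f] by (simp add: eq)
  qed
  moreover have "base M' \<in> f ` N" using imageI[OF N(2), of f] f(2) by simp
  moreover have "f ` N \<subseteq> elems M'" using N(1) f(1) by blast
  ultimately show ?thesis by (simp add: submodules_def)
qed

lemma image_flag:
  assumes "module_hom M M' f" "f ` elems M = elems M'" "C \<in> flags M"
  shows "image f ` C \<in> flags M'"
proof -
  have "f ` {base M} = {base M'}" using assms(1) by (simp add: module_hom_def)
  moreover have "{base M} \<in> C" "elems M \<in> C" using assms(3) by (auto simp: flags_def)
  ultimately have "{base M'} \<in> image f ` C" "elems M' \<in> image f ` C"
    using imageI[of "{base M}" C "image f"] imageI[of "elems M" C "image f"] assms(2)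
    by (simp_all only:)
  moreover have "image f ` C \<subseteq> submodules M'"
    using image_submodule[OF assms(1)] flags_subset[OF assms(3)] by blast
  moreover have "D \<subseteq> E \<or> E \<subseteq> D" if "D \<in> image f ` C" "E \<in> image f ` C" for D E
  proof -
    obtain D' E' where "D' \<in> C" "E' \<in> C" "D = f ` D'" "E = f ` E'"
      using \<open>D \<in> image f ` C\<close> \<open>E \<in> image f ` C\<close> by blast
    moreover from this have "D' \<subseteq> E' \<or> E' \<subseteq> D'"
      using assms(3) by (simp add: flags_def submodule_chains_def)
    ultimately show ?thesis by blast
  qed
  ultimately show ?thesis by (simp add: flags_def submodule_chains_def)
qed

text \<open>A step drops in \<open>M\<close> exactly when its image drops in \<open>M'\<close>,
  because the injective \<open>f\<close> reflects membership in the members of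
  \<open>C\<close>.\<close>

lemma module_iso_graded:
  assumes M: "fin_module M" and f: "module_hom M M' f" "bij_betw f (elems M) (elems M')"
    and C: "C \<subseteq> submodules M"
  shows "module_iso (graded M C) (graded M' (image f ` C))"
proof (rule module_isoI[of f])
  show "bij_betw f (elems (graded M C)) (elems (graded M' (image f ` C)))"
    using f(2) by (simp add: graded_def)
  show "f (base (graded M C)) = base (graded M' (image f ` C))"
    using f(1) by (simp add: graded_def module_hom_def)
  fix a m assume "m \<in> elems (graded M C)"
  then have m: "m \<in> elems M" by (simp add: graded_def)
  then have am: "act M a m \<in> elems M" by (rule act_closed[OF M])
  have inj: "inj_on f (elems M)" using f(2) by (simp add: bij_betw_def)
  have "f n \<in> f ` N \<longleftrightarrow> n \<in> N" if "N \<in> C" "n \<in> elems M" for N n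
  proof (rule inj_on_image_mem_iff[OF inj that(2)])
    show "N \<subseteq> elems M" using that(1) C unfolding submodules_def by blast
  qed
  then have "(\<exists>N\<in>C. m \<notin> N \<and> act M a m \<in> N) \<longleftrightarrow> (\<exists>N\<in>image f ` C. f m \<notin> N \<and> f (act M a m) \<in> N)"
    using m am by simp
  moreover have "act M' a (f m) = f (act M a m)" "f (base M) = base M'"
    using f(1) m by (simp_all add: module_hom_def)
  ultimately show "f (act (graded M C) a m) = act (graded M' (image f ` C)) a (f m)"
    by (simp only: graded_def amodule.simps if_distrib[of f])
qed

text \<open>Flags are carried over memberwise, keeping their length and their graded module. This
  frees the antipode formula from the choice of \<open>class_rep\<close>.\<close>

lemma sum_flags_module_iso:
  fixes h :: "'a::{monoid_mult,mult_zero} iso_class \<Rightarrow> rat"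
    and M :: "('a, 'm) amodule" and M' :: "('a, 'n) amodule"
  assumes M: "fin_module M" and M': "fin_module M'" and iso: "module_iso M M'"
  shows "(\<Sum>C\<in>flags M. (- 1) ^ (card C + 1) * h (mod_class (graded M C))) =
    (\<Sum>C\<in>flags M'. (- 1) ^ (card C + 1) * h (mod_class (graded M' C)))"
proof -
  obtain f g where f: "module_hom M M' f" and g: "module_hom M' M g"
    and gf: "\<And>m. m \<in> elems M \<Longrightarrow> g (f m) = m" and fg: "\<And>n. n \<in> elems M' \<Longrightarrow> f (g n) = n"
    using module_iso_obtain_inverse[OF M iso] by blast
  have cl: "f ` elems M \<subseteq> elems M'" "g ` elems M' \<subseteq> elems M"
    using f g by (simp_all add: module_hom_def)
  have bij: "bij_betw f (elems M) (elems M')"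
    by (rule bij_betw_byWitness[where f' = g]) (simp_all add: gf fg cl)
  have bij': "bij_betw g (elems M') (elems M)"
    by (rule bij_betw_byWitness[where f' = f]) (simp_all add: gf fg cl)
  have gfN: "g ` f ` N = N" if "N \<in> submodules M" for N
  proof -
    have "\<forall>m\<in>N. g (f m) = m" using gf that by (auto simp: submodules_def)
    then show ?thesis by (simp add: image_image)
  qed
  have fgN: "f ` g ` N = N" if "N \<in> submodules M'" for N
  proof -
    have "\<forall>m\<in>N. f (g m) = m" using fg that by (auto simp: submodules_def)
    then show ?thesis by (simp add: image_image)
  qed
  have gfC: "image g ` image f ` C = C" if "C \<in> flags M" for C
  proof -
    have "\<forall>N\<in>C. g ` f ` N = N" using gfN subsetD[OF flags_subset[OF that]] by simp
    then show ?thesis by (simp add: image_image[of "image g"])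
  qed
  have fgC: "image f ` image g ` C = C" if "C \<in> flags M'" for C
  proof -
    have "\<forall>N\<in>C. f ` g ` N = N" using fgN subsetD[OF flags_subset[OF that]] by simp
    then show ?thesis by (simp add: image_image[of "image f"])
  qed
  have fC: "image f ` C \<in> flags M'" if "C \<in> flags M" for C
    using image_flag[OF f _ that] bij by (simp add: bij_betw_def)
  have gC: "image g ` C \<in> flags M" if "C \<in> flags M'" for C
    using image_flag[OF g _ that] bij' by (simp add: bij_betw_def)
  have "bij_betw (image (image f)) (flags M) (flags M')"
  proof (rule bij_betw_byWitness[where f' = "image (image g)"])
    show "\<forall>C\<in>flags M. image g ` image f ` C = C" by (rule ballI) (rule gfC)
    show "\<forall>C\<in>flags M'. image f ` image g ` C = C" by (rule ballI) (rule fgC)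
    show "image (image f) ` flags M \<subseteq> flags M'" by (rule image_subsetI) (rule fC)
    show "image (image g) ` flags M' \<subseteq> flags M" by (rule image_subsetI) (rule gC)
  qed
  then have "(\<Sum>C\<in>flags M'. (- 1) ^ (card C + 1) * h (mod_class (graded M' C))) =
    (\<Sum>C\<in>flags M. (- 1) ^ (card (image f ` C) + 1) * h (mod_class (graded M' (image f ` C))))"
    by (rule sum.reindex_bij_betw[symmetric])
  also have "\<dots> = (\<Sum>C\<in>flags M. (- 1) ^ (card C + 1) * h (mod_class (graded M C)))"
  proof (rule sum.cong[OF refl])
    fix C assume C: "C \<in> flags M"
    have "inj_on (image f) C"
      by (rule inj_on_inverseI[where g = "image g"]) (rule gfN[OF subsetD[OF flags_subset[OF C]]])
    then have card: "card (image f ` C) = card C" by (rule card_image)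
    have "image f ` C \<subseteq> submodules M'" using fC[OF C] by (rule flags_subset)
    then have "mod_class (graded M C) = mod_class (graded M' (image f ` C))"
      by (intro mod_class_eqI module_iso_graded fin_module_graded M M' f bij flags_subset[OF C])
    then show "(- 1) ^ (card (image f ` C) + 1) * h (mod_class (graded M' (image f ` C))) =
        (- 1) ^ (card C + 1) * h (mod_class (graded M C))"
      by (simp only: card)
  qed
  finally show ?thesis ..
qed

text \<open>The end \<open>y\<close> is kept and the other end \<open>x\<close> is toggled, which
  does not change the class of the graded module, so everything cancels when the ends differ. For
  the zero module the ends coincide and the only chain, with one member, has sign
  \<open>+1\<close>.\<close>

lemma sum_chains_fixed_end:
  fixes h :: "'a::{monoid_mult,mult_zero} iso_class \<Rightarrow> rat" and M :: "('a, 'm) amodule"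
  assumes M: "fin_module M" and ends: "{x, y} = {{base M}, elems M}"
  shows "(\<Sum>C | C \<in> submodule_chains M \<and> y \<in> C. (- 1) ^ (card C + 1) * h (mod_class (graded M C)))
    = (if elems M = {base M} then h (mod_class zero_module) else 0)"
proof (cases "elems M = {base M}")
  case True
  then have "submodules M = {{base M}}" "y = {base M}"
    using M ends by (auto simp: submodules_def fin_module_def)
  then have "{C. C \<in> submodule_chains M \<and> y \<in> C} = {{{base M}}}"
    by (auto simp: submodule_chains_def)
  moreover have "fin_module (graded M {{base M}})"
    by (intro fin_module_graded M) (simp add: zero_submodule M)
  then have "mod_class (graded M {{base M}}) = mod_class zero_module"
    by (simp add: mod_class_eq_zero_iff) (simp add: graded_def True)
  ultimately show ?thesis by (simp add: True)
next
  case False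
  then have xy: "x \<noteq> y" using ends by (metis doubleton_eq_iff)
  have x: "x = {base M} \<or> x = elems M" using ends by blast
  have x_sub: "x \<in> submodules M" using x zero_submodule[OF M] elems_submodule[OF M] by blast
  \<comment> \<open>An end is comparable with every submodule, so inserting it keeps a chain a
    chain.\<close>
  have comparable: "x \<subseteq> N \<or> N \<subseteq> x" if "N \<in> submodules M" for N
    using x that by (auto simp: submodules_def)
  have "(\<Sum>C | C \<in> submodule_chains M \<and> y \<in> C. (- 1) ^ (card C + 1) * h (mod_class (graded M C))) = 0"
  proof (rule sum_toggle_eq_0[where x = x])
    fix C assume "C \<in> {C. C \<in> submodule_chains M \<and> y \<in> C}"
    then have C: "C \<in> submodule_chains M" "y \<in> C" "C \<subseteq> submodules M"
      using submodule_chains_subset by auto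
    show "finite C" using finite_chain[OF M C(1)] .
    have "insert x C \<in> submodule_chains M"
      using C x_sub comparable unfolding submodule_chains_def by blast
    moreover have "C - {x} \<in> submodule_chains M"
      using C(1) by (auto simp: submodule_chains_def)
    ultimately show "insert x C \<in> {C. C \<in> submodule_chains M \<and> y \<in> C} \<and>
        C - {x} \<in> {C. C \<in> submodule_chains M \<and> y \<in> C}"
      using C xy by blast
    have "module_iso (graded M (insert x C)) (graded M C)"
      using x
    proof
      assume "x = {base M}"
      then show ?thesis by (simp add: graded_insert_zero[OF M] module_iso_refl)
    next
      assume "x = elems M"
      then show ?thesis by (simp add: module_iso_graded_insert_elems)
    qed
    then have "mod_class (graded M (insert x C)) = mod_class (graded M C)"
      using C x_sub by (intro mod_class_eqI fin_module_graded M) auto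
    then show "h (mod_class (graded M (insert x C))) = h (mod_class (graded M C))" by simp
  qed
  then show ?thesis using False by simp
qed


section \<open>The antipode\<close>

lemma sum_fun_apply: "(\<Sum>i\<in>I. f i) x = (\<Sum>i\<in>I. f i x)"
  for f :: "'i \<Rightarrow> 'x \<Rightarrow> rat"
  by (induction I rule: infinite_finite_induct) auto

lemma sum_supp_delta_delta:
  assumes "finite (supp t)"
  shows "(\<Sum>(x, y)\<in>supp t. t (x, y) * (delta x X * delta y Y)) = t (X, Y)"
proof -
  have "(\<Sum>(x, y)\<in>supp t. t (x, y) * (delta x X * delta y Y)) =
      (\<Sum>p\<in>supp t. if (X, Y) = p then t p else 0)"
    by (intro sum.cong refl) (auto simp: delta_def split: if_splits)
  also have "\<dots> = t (X, Y)"
    using assms by (simp add: supp_def)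
  finally show ?thesis .
qed

text \<open>After exchanging the sums, each pair of deltas picks out one value of \<open>t\<close>.
  This evaluates \<open>mult_map\<close> and \<open>tensor_map\<close>, which expand
  \<open>t\<close> in the delta basis.\<close>

lemma sum_supp_weighted:
  assumes "finite (supp t)"
  shows "(\<Sum>(x, y)\<in>supp t. t (x, y) * (\<Sum>i\<in>I. w i * (delta x (a i) * delta y (b i)))) =
    (\<Sum>i\<in>I. w i * t (a i, b i))"
proof -
  have "(\<Sum>(x, y)\<in>supp t. t (x, y) * (\<Sum>i\<in>I. w i * (delta x (a i) * delta y (b i)))) =
      (\<Sum>p\<in>supp t. \<Sum>i\<in>I. w i * (t p * (delta (fst p) (a i) * delta (snd p) (b i))))"
    by (intro sum.cong refl) (auto simp: sum_distrib_left mult_ac)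
  also have "\<dots> = (\<Sum>i\<in>I. \<Sum>p\<in>supp t. w i * (t p * (delta (fst p) (a i) * delta (snd p) (b i))))"
    by (rule sum.swap)
  also have "\<dots> = (\<Sum>i\<in>I. w i * t (a i, b i))"
    unfolding sum_distrib_left[symmetric] using sum_supp_delta_delta[OF assms]
    by (simp add: case_prod_unfold)
  finally show ?thesis .
qed

lemma mult_map_hall:
  fixes t :: "'a::{monoid_mult,mult_zero} iso_class \<times> 'a iso_class \<Rightarrow> rat"
  assumes "finite (supp t)"
  shows "mult_map hall_mult t X = (\<Sum>N\<in>submodules (class_rep X).
    t (mod_class (quot_module (class_rep X) N), mod_class (sub_module (class_rep X) N)))"
proof -
  have "mult_map hall_mult t X = (\<Sum>(x, y)\<in>supp t. t (x, y) *
      (\<Sum>N\<in>submodules (class_rep X). 1 * (delta x (mod_class (quot_module (class_rep X) N)) *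
        delta y (mod_class (sub_module (class_rep X) N)))))"
    by (simp add: mult_map_def sum_fun_apply case_prod_unfold qscale_def hall_mult_def Let_def)
  then show ?thesis
    unfolding sum_supp_weighted[OF assms, where w = "\<lambda>_. 1"] by simp
qed

text \<open>
  The Hall algebra is dual to the Hopf algebra with basis the classes \<open>[M]\<close>, product
  \<open>[M][N] = [M \<oplus> N]\<close> and coproduct \<open>\<Sum>\<^sub>N [M/N] \<otimes> [N]\<close>; this is the transpose of Takeuchi's
  formula for the antipode of that algebra.
\<close>

definition hall_antipode ::
  "('a::{monoid_mult,mult_zero} iso_class \<Rightarrow> rat) \<Rightarrow> 'a iso_class \<Rightarrow> rat" where
  "hall_antipode f X =
     (let M = class_rep X in
      \<Sum>C\<in>flags M. (- 1) ^ (card C + 1) * f (mod_class (graded M C)))"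

lemma hall_antipode_mod_class:
  assumes "fin_module M"
  shows "hall_antipode f (mod_class M) =
    (\<Sum>C\<in>flags M. (- 1) ^ (card C + 1) * f (mod_class (graded M C)))"
  unfolding hall_antipode_def Let_def
  by (intro sum_flags_module_iso class_rep assms module_iso_class_rep)

lemma tensor_map_hall_antipode_id:
  assumes "finite (supp t)"
  shows "tensor_map hall_antipode id t (X, Y) = hall_antipode (\<lambda>Z. t (Z, Y)) X"
proof -
  let ?M = "class_rep X"
  have "tensor_map hall_antipode id t (X, Y) = (\<Sum>(x, y)\<in>supp t. t (x, y) *
      (\<Sum>C\<in>flags ?M. (- 1) ^ (card C + 1) * (delta x (mod_class (graded ?M C)) * delta y Y)))"
    by (simp add: tensor_map_def sum_fun_apply case_prod_unfold qscale_def tensor_def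
        hall_antipode_def Let_def sum_distrib_right mult.assoc)
  then show ?thesis
    by (simp only: sum_supp_weighted[OF assms] hall_antipode_def Let_def)
qed

lemma tensor_map_id_hall_antipode:
  assumes "finite (supp t)"
  shows "tensor_map id hall_antipode t (X, Y) = hall_antipode (\<lambda>Z. t (X, Z)) Y"
proof -
  let ?M = "class_rep Y"
  have "tensor_map id hall_antipode t (X, Y) = (\<Sum>(x, y)\<in>supp t. t (x, y) *
      (\<Sum>C\<in>flags ?M. (- 1) ^ (card C + 1) * (delta x X * delta y (mod_class (graded ?M C)))))"
    by (simp add: tensor_map_def sum_fun_apply case_prod_unfold qscale_def tensor_def
        hall_antipode_def Let_def sum_distrib_left mult_ac)
  then show ?thesis
    by (simp only: sum_supp_weighted[OF assms] hall_antipode_def Let_def)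
qed

section \<open>Finiteness of supports\<close>

lemma supp_delta: "supp (delta x) = {x}"
  by (auto simp: supp_def delta_def)

lemma delta_fin_supp: "delta x \<in> fin_supp"
  by (simp add: fin_supp_def supp_delta)

text \<open>Required before \<open>mult_map\<close> is applied: its sum over an infinite support
  would be \<open>0\<close> by convention.\<close>

lemma finite_supp_tensor_map:
  assumes "F ` fin_supp \<subseteq> fin_supp" "G ` fin_supp \<subseteq> fin_supp" "finite (supp t)"
  shows "finite (supp (tensor_map F G t))"
proof (rule finite_subset)
  show "supp (tensor_map F G t) \<subseteq> (\<Union>(x, y)\<in>supp t. supp (F (delta x)) \<times> supp (G (delta y)))"
  proof
    fix p assume "p \<in> supp (tensor_map F G t)"
    moreover have "tensor_map F G t p =
        (\<Sum>q\<in>supp t. t q * (F (delta (fst q)) (fst p) * G (delta (snd q)) (snd p)))"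
      by (simp add: tensor_map_def sum_fun_apply case_prod_unfold qscale_def tensor_def)
    ultimately have "(\<Sum>q\<in>supp t. t q * (F (delta (fst q)) (fst p) * G (delta (snd q)) (snd p))) \<noteq> 0"
      by (simp add: supp_def)
    then obtain q where "q \<in> supp t" "t q * (F (delta (fst q)) (fst p) * G (delta (snd q)) (snd p)) \<noteq> 0"
      by (rule sum.not_neutral_contains_not_neutral)
    then have "q \<in> supp t" "p \<in> supp (F (delta (fst q))) \<times> supp (G (delta (snd q)))"
      by (auto simp: supp_def mem_Times_iff)
    then show "p \<in> (\<Union>(x, y)\<in>supp t. supp (F (delta x)) \<times> supp (G (delta y)))"
      by (auto simp: case_prod_unfold)
  qed
  have "finite (supp (F (delta x)))" "finite (supp (G (delta x)))" for x
    using assms(1,2) delta_fin_supp[of x] by (auto simp: fin_supp_def image_subset_iff)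
  then show "finite (\<Union>(x, y)\<in>supp t. supp (F (delta x)) \<times> supp (G (delta y)))"
    using assms(3) by auto
qed

text \<open>A graded module has the carrier of \<open>M\<close>, so a cardinality bound for
  \<open>f\<close> is one for its antipode.\<close>

lemma hall_antipode_fin_supp:
  fixes f :: "'a::{monoid_mult,mult_zero} iso_class \<Rightarrow> rat"
  assumes fg: "\<exists>G :: 'a set. finite G \<and> monoid_gen G = UNIV" and f: "f \<in> fin_supp"
  shows "hall_antipode f \<in> fin_supp"
proof -
  obtain n where n: "\<And>M :: ('a, nat) amodule. fin_module M \<Longrightarrow> f (mod_class M) \<noteq> 0 \<Longrightarrow> card (elems M) \<le> n"
    using fin_supp_mod_class_bound[OF f] by blast
  show ?thesis
  proof (rule fin_suppI_card_bound[OF fg])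
    fix X assume "hall_antipode f X \<noteq> 0"
    then obtain C where C: "C \<in> flags (class_rep X)" "f (mod_class (graded (class_rep X) C)) \<noteq> 0"
      unfolding hall_antipode_def Let_def
      by (metis (no_types, lifting) mult_zero_right sum.neutral)
    then show "card (elems (class_rep X)) \<le> n"
      using n[OF fin_module_graded[OF class_rep(1) flags_subset]] by (simp add: graded_def)
  qed
qed

lemma finite_supp_hall_comult:
  fixes f :: "'a::{monoid_mult,mult_zero} iso_class \<Rightarrow> rat"
  assumes fg: "\<exists>G :: 'a set. finite G \<and> monoid_gen G = UNIV" and f: "f \<in> fin_supp"
  shows "finite (supp (hall_comult f))"
proof -
  obtain n where n: "\<And>M :: ('a, nat + nat) amodule. fin_module M \<Longrightarrow> f (mod_class M) \<noteq> 0 \<Longrightarrow> card (elems M) \<le> n"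
    using fin_supp_mod_class_bound[OF f] by blast
  let ?S = "{X :: 'a iso_class. card (elems (class_rep X)) \<le> n}"
  have "supp (hall_comult f) \<subseteq> ?S \<times> ?S"
  proof
    fix p assume "p \<in> supp (hall_comult f)"
    then have "f (mod_class (wedge (class_rep (fst p)) (class_rep (snd p)))) \<noteq> 0"
      by (simp add: supp_def hall_comult_def case_prod_unfold)
    then have "card (elems (wedge (class_rep (fst p)) (class_rep (snd p)))) \<le> n"
      by (intro n fin_module_wedge class_rep)
    then show "p \<in> ?S \<times> ?S"
      using card_le_wedge[OF class_rep(1)[of "fst p"] class_rep(1)[of "snd p"]]
      by (simp add: mem_Times_iff)
  qed
  then show ?thesis
    using finite_classes_of_bounded_card[OF fg, of n] by (meson finite_SigmaI finite_subset)
qed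

lemma hall_comult_mod_class:
  "fin_module M \<Longrightarrow> fin_module N \<Longrightarrow> hall_comult f (mod_class M, mod_class N) = f (mod_class (wedge M N))"
  by (simp add: hall_comult_def mod_class_wedge_class_rep)

section \<open>The two antipode identities\<close>

lemma hall_counit_unit:
  "qscale (hall_counit f) hall_unit X =
    (if elems (class_rep X) = {base (class_rep X)} then f (mod_class zero_module) else 0)"
proof -
  have "X = mod_class zero_module \<longleftrightarrow> elems (class_rep X) = {base (class_rep X)}"
    using mod_class_eq_zero_iff[OF class_rep(1)[of X]] class_rep(2)[of X] by simp
  then show ?thesis by (simp add: qscale_def hall_counit_def hall_unit_def delta_def)
qed

lemma hall_antipode_left:
  fixes f :: "'a::{monoid_mult,mult_zero} iso_class \<Rightarrow> rat"
  assumes fg: "\<exists>G :: 'a set. finite G \<and> monoid_gen G = UNIV" and f: "f \<in> fin_supp"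
  shows "mult_map hall_mult (tensor_map hall_antipode id (hall_comult f)) = qscale (hall_counit f) hall_unit"
proof
  fix X :: "'a iso_class"
  define M where "M = class_rep X"
  have M: "fin_module M" by (simp add: M_def class_rep)
  let ?w = "\<lambda>C. (- 1) ^ (card C + 1) * f (mod_class (graded M C))"
  let ?\<C> = "{C. C \<in> submodule_chains M \<and> elems M \<in> C}"
  note fin = finite_supp_hall_comult[OF fg f]
  have "finite (supp (tensor_map hall_antipode id (hall_comult f)))"
    using hall_antipode_fin_supp[OF fg] by (intro finite_supp_tensor_map fin) auto
  then have "mult_map hall_mult (tensor_map hall_antipode id (hall_comult f)) X = (\<Sum>N\<in>submodules M.
      hall_antipode (\<lambda>Z. hall_comult f (Z, mod_class (sub_module M N))) (mod_class (quot_module M N)))"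
    by (simp add: mult_map_hall tensor_map_hall_antipode_id[OF fin] M_def)
  \<comment> \<open>The summand at \<open>N\<close> collects the chains ending in
    \<open>elems M\<close> whose first member is \<open>N\<close>.\<close>
  also have "\<dots> = (\<Sum>N\<in>submodules M. \<Sum>C | C \<in> ?\<C> \<and> \<Inter>C = N. ?w C)"
  proof (rule sum.cong[OF refl])
    fix N assume N: "N \<in> submodules M"
    have "hall_antipode (\<lambda>Z. hall_comult f (Z, mod_class (sub_module M N))) (mod_class (quot_module M N))
        = (\<Sum>C\<in>flags (quot_module M N). (- 1) ^ (card C + 1) *
            hall_comult f (mod_class (graded (quot_module M N) C), mod_class (sub_module M N)))"
      by (rule hall_antipode_mod_class[OF fin_module_quot[OF M N]])
    \<comment> \<open>The wedge of the graded quotient with \<open>N\<close> is the graded module of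
      the lifted chain.\<close>
    also have "\<dots> = (\<Sum>C\<in>flags (quot_module M N). ?w ((\<lambda>D. D \<union> N) ` C))"
    proof (rule sum.cong[OF refl])
      fix C assume C: "C \<in> flags (quot_module M N)"
      have C': "C \<subseteq> submodules (quot_module M N)" "{base M} \<in> C"
        using C flags_subset[OF C] by (auto simp: flags_def quot_module_def)
      have "(\<lambda>D. D \<union> N) ` C \<in> {C \<in> submodule_chains M. elems M \<in> C \<and> \<Inter>C = N}"
        using bij_betw_flags_quot_module[OF M N] C by (auto simp only: bij_betw_def)
      then have up: "(\<lambda>D. D \<union> N) ` C \<subseteq> submodules M"
        using submodule_chains_subset by blast
      have card: "card ((\<lambda>D. D \<union> N) ` C) = card C"
        using inj_on_subset[OF inj_on_union_quot[OF N] C'(1)] by (rule card_image)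
      note gr = fin_module_graded[OF fin_module_quot[OF M N] C'(1)]
      have "mod_class (graded M ((\<lambda>D. D \<union> N) ` C)) =
          mod_class (wedge (graded (quot_module M N) C) (sub_module M N))"
        by (intro mod_class_eqI fin_module_wedge gr fin_module_sub N fin_module_graded up M
            module_iso_graded_quot C')
      then show "(- 1) ^ (card C + 1) *
            hall_comult f (mod_class (graded (quot_module M N) C), mod_class (sub_module M N))
          = ?w ((\<lambda>D. D \<union> N) ` C)"
        by (simp add: card hall_comult_mod_class[OF gr fin_module_sub[OF M N]])
    qed
    also have "\<dots> = (\<Sum>C | C \<in> ?\<C> \<and> \<Inter>C = N. ?w C)"
      using sum.reindex_bij_betw[OF bij_betw_flags_quot_module[OF M N], of ?w] by (simp add: conj_assoc)
    finally show "hall_antipode (\<lambda>Z. hall_comult f (Z, mod_class (sub_module M N)))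
        (mod_class (quot_module M N)) = (\<Sum>C | C \<in> ?\<C> \<and> \<Inter>C = N. ?w C)" .
  qed
  \<comment> \<open>Every such chain has exactly one first member, so the groups exhaust
    \<open>?\<C>\<close>.\<close>
  also have "\<dots> = (\<Sum>C\<in>?\<C>. ?w C)"
  proof (rule sum.group)
    show "finite ?\<C>" using finite_submodule_chains[OF M] by simp
    show "finite (submodules M)" using finite_submodules[OF M] .
    show "Inter ` ?\<C> \<subseteq> submodules M"
      using Inter_mem_chain[OF M] submodule_chains_subset by blast
  qed
  also have "\<dots> = qscale (hall_counit f) hall_unit X"
    using sum_chains_fixed_end[OF M, of "{base M}" "elems M" f] hall_counit_unit[of f X]
    by (simp add: M_def)
  finally show "mult_map hall_mult (tensor_map hall_antipode id (hall_comult f)) X =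
    qscale (hall_counit f) hall_unit X" .
qed

text \<open>The mirror argument: chains starting at \<open>{base M}\<close> are grouped by their
  last member, and \<open>elems M\<close> is toggled.\<close>

lemma hall_antipode_right:
  fixes f :: "'a::{monoid_mult,mult_zero} iso_class \<Rightarrow> rat"
  assumes fg: "\<exists>G :: 'a set. finite G \<and> monoid_gen G = UNIV" and f: "f \<in> fin_supp"
  shows "mult_map hall_mult (tensor_map id hall_antipode (hall_comult f)) = qscale (hall_counit f) hall_unit"
proof
  fix X :: "'a iso_class"
  define M where "M = class_rep X"
  have M: "fin_module M" by (simp add: M_def class_rep)
  let ?w = "\<lambda>C. (- 1) ^ (card C + 1) * f (mod_class (graded M C))"
  let ?\<C> = "{C. C \<in> submodule_chains M \<and> {base M} \<in> C}"
  note fin = finite_supp_hall_comult[OF fg f]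
  have "finite (supp (tensor_map id hall_antipode (hall_comult f)))"
    using hall_antipode_fin_supp[OF fg] by (intro finite_supp_tensor_map fin) auto
  then have "mult_map hall_mult (tensor_map id hall_antipode (hall_comult f)) X = (\<Sum>N\<in>submodules M.
      hall_antipode (\<lambda>Z. hall_comult f (mod_class (quot_module M N), Z)) (mod_class (sub_module M N)))"
    by (simp add: mult_map_hall tensor_map_id_hall_antipode[OF fin] M_def)
  also have "\<dots> = (\<Sum>N\<in>submodules M. \<Sum>C | C \<in> ?\<C> \<and> \<Union>C = N. ?w C)"
  proof (rule sum.cong[OF refl])
    fix N assume N: "N \<in> submodules M"
    have "hall_antipode (\<lambda>Z. hall_comult f (mod_class (quot_module M N), Z)) (mod_class (sub_module M N))
        = (\<Sum>C\<in>flags (sub_module M N). (- 1) ^ (card C + 1) *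
            hall_comult f (mod_class (quot_module M N), mod_class (graded (sub_module M N) C)))"
      by (rule hall_antipode_mod_class[OF fin_module_sub[OF M N]])
    also have "\<dots> = (\<Sum>C\<in>flags (sub_module M N). ?w C)"
    proof (rule sum.cong[OF refl])
      fix C assume C: "C \<in> flags (sub_module M N)"
      have C': "C \<subseteq> submodules (sub_module M N)" "N \<in> C"
        using C flags_subset[OF C] by (auto simp: flags_def sub_module_def)
      have up: "C \<subseteq> submodules M"
        using C'(1) submodules_sub_module[OF N] by blast
      note gr = fin_module_graded[OF fin_module_sub[OF M N] C'(1)]
      have "mod_class (graded M C) = mod_class (wedge (quot_module M N) (graded (sub_module M N) C))"
        by (intro mod_class_eqI fin_module_wedge gr fin_module_quot N fin_module_graded up M
            module_iso_graded_sub C')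
      then show "(- 1) ^ (card C + 1) *
            hall_comult f (mod_class (quot_module M N), mod_class (graded (sub_module M N) C)) = ?w C"
        by (simp add: hall_comult_mod_class[OF fin_module_quot[OF M N] gr])
    qed
    also have "\<dots> = (\<Sum>C | C \<in> ?\<C> \<and> \<Union>C = N. ?w C)"
      unfolding flags_sub_module[OF M N] by (simp add: conj_assoc)
    finally show "hall_antipode (\<lambda>Z. hall_comult f (mod_class (quot_module M N), Z))
        (mod_class (sub_module M N)) = (\<Sum>C | C \<in> ?\<C> \<and> \<Union>C = N. ?w C)" .
  qed
  also have "\<dots> = (\<Sum>C\<in>?\<C>. ?w C)"
  proof (rule sum.group)
    show "finite ?\<C>" using finite_submodule_chains[OF M] by simp
    show "finite (submodules M)" using finite_submodules[OF M] .
    show "Union ` ?\<C> \<subseteq> submodules M"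
      using Union_mem_chain[OF M] submodule_chains_subset by blast
  qed
  also have "\<dots> = qscale (hall_counit f) hall_unit X"
    using sum_chains_fixed_end[OF M, of "elems M" "{base M}" f] hall_counit_unit[of f X]
    by (simp add: M_def insert_commute)
  finally show "mult_map hall_mult (tensor_map id hall_antipode (hall_comult f)) X =
    qscale (hall_counit f) hall_unit X" .
qed

lemma is_antipode_hall_antipode:
  assumes fg: "\<exists>G :: 'a::{monoid_mult,mult_zero} set. finite G \<and> monoid_gen G = UNIV"
  shows "is_antipode hall_mult (hall_unit :: 'a iso_class \<Rightarrow> rat) hall_comult hall_counit hall_antipode"
proof -
  have "hall_antipode (f + g) = hall_antipode f + hall_antipode g" for f g :: "'a iso_class \<Rightarrow> rat"
    by (rule ext) (simp only: hall_antipode_def Let_def plus_fun_apply distrib_left sum.distrib)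
  moreover have "hall_antipode (qscale c f) = qscale c (hall_antipode f)" for c and f :: "'a iso_class \<Rightarrow> rat"
    by (auto simp: fun_eq_iff hall_antipode_def Let_def qscale_def sum_distrib_left mult_ac)
  ultimately show ?thesis
    unfolding is_antipode_def
    using hall_antipode_fin_supp[OF fg] hall_antipode_left[OF fg] hall_antipode_right[OF fg] by blast
qed


section \<open>Modules of type \<open>\<alpha>\<close>\<close>

lemma type_alpha_iso:
  assumes "fin_module M" "module_iso M N" "type_alpha N"
  shows "type_alpha M"
  unfolding type_alpha_def
proof (intro allI ballI impI)
  fix a m1 m2 assume m: "m1 \<in> elems M" "m2 \<in> elems M"
    and eq: "act M a m1 = act M a m2 \<and> act M a m1 \<noteq> base M"
  obtain f where f: "module_hom M N f" "inj_on f (elems M)"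
    using assms(2) by (auto simp: module_iso_def bij_betw_def)
  have am: "act M a m1 \<in> elems M" "base M \<in> elems M"
    using assms(1) m by (auto simp: fin_module_def)
  have f_act: "f (act M a m1) = act N a (f m1)" "f (act M a m2) = act N a (f m2)"
    and fb: "f (base M) = base N" and fm: "f m1 \<in> elems N" "f m2 \<in> elems N"
    using f(1) m by (auto simp: module_hom_def)
  have "act N a (f m1) = act N a (f m2)" using f_act eq by simp
  moreover have "act N a (f m1) \<noteq> base N"
    using inj_onD[OF f(2) _ am] eq f_act(1) fb by auto
  ultimately have "f m1 = f m2" using assms(3) fm unfolding type_alpha_def by blast
  then show "m1 = m2" using inj_onD[OF f(2)] m by blast
qed

lemma type_alpha_class_rep:
  "fin_module M \<Longrightarrow> type_alpha (class_rep (mod_class M)) \<longleftrightarrow> type_alpha M"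
  using type_alpha_iso module_iso_class_rep module_iso_sym class_rep(1) by metis

lemma type_alpha_sub: "type_alpha M \<Longrightarrow> N \<in> submodules M \<Longrightarrow> type_alpha (sub_module M N)"
  unfolding type_alpha_def submodules_def sub_module_def by auto

text \<open>Nonzero values of the quotient action are values of the action on
  \<open>M\<close>.\<close>

lemma type_alpha_quot:
  assumes "fin_module M" "type_alpha M"
  shows "type_alpha (quot_module M N)"
  unfolding type_alpha_def
proof (intro allI ballI impI)
  fix a m1 m2 assume "m1 \<in> elems (quot_module M N)" "m2 \<in> elems (quot_module M N)"
    and eq: "act (quot_module M N) a m1 = act (quot_module M N) a m2 \<and>
      act (quot_module M N) a m1 \<noteq> base (quot_module M N)"
  then have "m1 \<in> elems M" "m2 \<in> elems M"
    using assms(1) by (auto simp: quot_module_def fin_module_def)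
  moreover have "act M a m1 = act M a m2" "act M a m1 \<noteq> base M"
    using eq by (auto simp: quot_module_def split: if_splits)
  ultimately show "m1 = m2" using assms(2) unfolding type_alpha_def by blast
qed

text \<open>Nonzero values stay in the summand of their argument, so equal ones come from the same
  summand.\<close>

lemma type_alpha_wedge:
  assumes "type_alpha M" "type_alpha N"
  shows "type_alpha (wedge M N)"
  unfolding type_alpha_def
proof (intro allI ballI impI)
  fix a x y assume x: "x \<in> elems (wedge M N)" and y: "y \<in> elems (wedge M N)"
    and eq: "act (wedge M N) a x = act (wedge M N) a y \<and> act (wedge M N) a x \<noteq> base (wedge M N)"
  have M: "m1 = m2"
    if "m1 \<in> elems M" "m2 \<in> elems M" "act M a m1 = act M a m2" "act M a m1 \<noteq> base M" for m1 m2
    using assms(1) that unfolding type_alpha_def by blast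
  have N: "m1 = m2"
    if "m1 \<in> elems N" "m2 \<in> elems N" "act N a m1 = act N a m2" "act N a m1 \<noteq> base N" for m1 m2
    using assms(2) that unfolding type_alpha_def by blast
  have inl: "act M a m \<noteq> base M" if "Inl m \<in> {x, y}" for m
    using that eq by (auto simp: wedge_def)
  have inr: "act N a n \<noteq> base N" if "Inr n \<in> {x, y}" for n
    using that eq by (auto simp: wedge_def)
  show "x = y"
  proof (cases x)
    case x': (Inl m1)
    show ?thesis
    proof (cases y)
      case (Inl m2)
      then show ?thesis using x x' y eq M[of m1 m2] inl by (auto simp: wedge_def)
    next
      case (Inr n2)
      then show ?thesis using x' eq inr by (simp add: wedge_def)
    qed
  next
    case x': (Inr n1)
    show ?thesis
    proof (cases y)
      case (Inl m2)
      then show ?thesis using x' eq inr by (simp add: wedge_def)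
    next
      case (Inr n2)
      then show ?thesis using x x' y eq N[of n1 n2] inr by (auto simp: wedge_def)
    qed
  qed
qed

lemma type_alpha_zero: "type_alpha zero_module"
  by (simp add: type_alpha_def zero_module_def)

section \<open>The subspace \<open>J_alpha\<close>: vanishing criterion, ideal and coideal
  properties\<close>

lemma subspace_fin_supp: "qfun.subspace fin_supp"
proof (unfold qfun.subspace_def, intro conjI ballI allI)
  show "0 \<in> fin_supp" by (simp add: fin_supp_def supp_def)
  show "f + g \<in> fin_supp" if "f \<in> fin_supp" "g \<in> fin_supp" for f g :: "'x \<Rightarrow> rat"
  proof -
    have "supp (f + g) \<subseteq> supp f \<union> supp g" by (auto simp: supp_def)
    then show ?thesis using that by (simp add: fin_supp_def finite_subset)
  qed
  show "qscale c f \<in> fin_supp" if "f \<in> fin_supp" for c and f :: "'x \<Rightarrow> rat"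
  proof -
    have "supp (qscale c f) \<subseteq> supp f" by (auto simp: supp_def qscale_def)
    then show ?thesis using that by (simp add: fin_supp_def finite_subset)
  qed
qed

lemma sum_supp_scale_delta:
  assumes "finite (supp f)"
  shows "(\<Sum>x\<in>supp f. qscale (f x) (delta x)) = f"
proof
  fix y
  have "(\<Sum>x\<in>supp f. qscale (f x) (delta x)) y = (\<Sum>x\<in>supp f. if y = x then f x else 0)"
    unfolding sum_fun_apply by (intro sum.cong refl) (auto simp: qscale_def delta_def)
  also have "\<dots> = f y" using assms by (simp add: supp_def)
  finally show "(\<Sum>x\<in>supp f. qscale (f x) (delta x)) y = f y" .
qed

text \<open>The vanishing condition defines a subspace containing the generators, as type \<alpha>
  is invariant under isomorphism. Conversely, a function in it is a finite combination of deltas at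
  classes not of type \<alpha>.\<close>

lemma J_alpha_eq:
  "(J_alpha :: ('a::{monoid_mult,mult_zero} iso_class \<Rightarrow> rat) set) =
    {f \<in> fin_supp. \<forall>X. type_alpha (class_rep X) \<longrightarrow> f X = 0}" (is "_ = ?V")
proof
  show "J_alpha \<subseteq> ?V"
    unfolding J_alpha_def
  proof (rule qfun.span_minimal)
    show "qfun.subspace ?V"
      using subspace_fin_supp by (auto simp: qfun.subspace_def qscale_def)
    show "{delta (mod_class M) | M :: ('a, nat) amodule. fin_module M \<and> \<not> type_alpha M} \<subseteq> ?V"
      by (auto simp: delta_fin_supp) (auto simp: delta_def type_alpha_class_rep)
  qed
  show "?V \<subseteq> J_alpha"
  proof
    fix f assume f: "f \<in> ?V"
    have "(\<Sum>X\<in>supp f. qscale (f X) (delta X)) \<in> J_alpha"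
      unfolding J_alpha_def
    proof (intro qfun.span_sum qfun.span_scale qfun.span_base)
      fix X assume "X \<in> supp f"
      then have "\<not> type_alpha (class_rep X)" using f by (auto simp: supp_def)
      then show "delta X \<in> {delta (mod_class M) | M :: ('a, nat) amodule. fin_module M \<and> \<not> type_alpha M}"
        using class_rep[of X] by (metis (mono_tags, lifting) mem_Collect_eq)
    qed
    then show "f \<in> J_alpha" using f by (simp add: sum_supp_scale_delta fin_supp_def)
  qed
qed

lemma J_alpha_eq_0:
  "f \<in> J_alpha \<Longrightarrow> fin_module M \<Longrightarrow> type_alpha M \<Longrightarrow> f (mod_class M) = 0"
  unfolding J_alpha_eq by (simp add: type_alpha_class_rep)

lemma hall_mult_fin_supp:
  fixes f g :: "'a::{monoid_mult,mult_zero} iso_class \<Rightarrow> rat"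
  assumes fg: "\<exists>G :: 'a set. finite G \<and> monoid_gen G = UNIV" and "f \<in> fin_supp" "g \<in> fin_supp"
  shows "hall_mult f g \<in> fin_supp"
proof -
  obtain n where n: "\<And>M :: ('a, nat) amodule. fin_module M \<Longrightarrow> f (mod_class M) \<noteq> 0 \<Longrightarrow> card (elems M) \<le> n"
    using fin_supp_mod_class_bound[OF assms(2)] by blast
  obtain k where k: "\<And>M :: ('a, nat) amodule. fin_module M \<Longrightarrow> g (mod_class M) \<noteq> 0 \<Longrightarrow> card (elems M) \<le> k"
    using fin_supp_mod_class_bound[OF assms(3)] by blast
  show ?thesis
  proof (rule fin_suppI_card_bound[OF fg])
    fix X assume X: "hall_mult f g X \<noteq> 0"
    let ?M = "class_rep X"
    have M: "fin_module ?M" by (rule class_rep)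
    obtain N where N: "N \<in> submodules ?M"
      and ne: "f (mod_class (quot_module ?M N)) * g (mod_class (sub_module ?M N)) \<noteq> 0"
      using X unfolding hall_mult_def Let_def by (rule sum.not_neutral_contains_not_neutral)
    have "card (elems (quot_module ?M N)) \<le> n" "card (elems (sub_module ?M N)) \<le> k"
      using ne n[OF fin_module_quot[OF M N]] k[OF fin_module_sub[OF M N]] by auto
    then show "card (elems ?M) \<le> n + k"
      using card_quot_module[OF M N] by (simp add: sub_module_def)
  qed
qed

text \<open>On a module of type \<alpha>, every summand of the product contains a value of
  \<open>j\<close> at a submodule or quotient, again of type \<alpha>.\<close>

lemma J_alpha_ideal:
  fixes f j :: "'a::{monoid_mult,mult_zero} iso_class \<Rightarrow> rat"
  assumes fg: "\<exists>G :: 'a set. finite G \<and> monoid_gen G = UNIV" and f: "f \<in> fin_supp" and j: "j \<in> J_alpha"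
  shows "hall_mult f j \<in> J_alpha" "hall_mult j f \<in> J_alpha"
proof -
  have j': "j \<in> fin_supp" using j by (simp add: J_alpha_eq)
  have "hall_mult f j X = 0 \<and> hall_mult j f X = 0" if X: "type_alpha (class_rep X)" for X
  proof -
    let ?M = "class_rep X"
    have M: "fin_module ?M" by (rule class_rep)
    have "j (mod_class (sub_module ?M N)) = 0" "j (mod_class (quot_module ?M N)) = 0"
      if N: "N \<in> submodules ?M" for N
      using J_alpha_eq_0[OF j fin_module_sub[OF M N] type_alpha_sub[OF X N]]
        J_alpha_eq_0[OF j fin_module_quot[OF M N] type_alpha_quot[OF M X]] by auto
    then show ?thesis by (simp add: hall_mult_def Let_def)
  qed
  then show "hall_mult f j \<in> J_alpha" "hall_mult j f \<in> J_alpha"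
    using hall_mult_fin_supp[OF fg f j'] hall_mult_fin_supp[OF fg j' f] by (simp_all add: J_alpha_eq)
qed

lemma delta_mem_J_alpha: "\<not> type_alpha (class_rep X) \<Longrightarrow> delta X \<in> J_alpha"
  unfolding J_alpha_eq by (auto simp: delta_fin_supp) (auto simp: delta_def)

text \<open>The delta expansion of the coproduct is split by whether the first component is of type
  \<alpha>.\<close>

lemma J_alpha_coideal:
  fixes j :: "'a::{monoid_mult,mult_zero} iso_class \<Rightarrow> rat"
  assumes fg: "\<exists>G :: 'a set. finite G \<and> monoid_gen G = UNIV" and j: "j \<in> J_alpha"
  shows "hall_comult j \<in>
    {u + v | u v. u \<in> tensor_space J_alpha fin_supp \<and> v \<in> tensor_space fin_supp J_alpha}"
proof -
  let ?t = "hall_comult j"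
  let ?term = "\<lambda>p. qscale (?t p) (tensor (delta (fst p)) (delta (snd p)))"
  have j': "j \<in> fin_supp" using j by (simp add: J_alpha_eq)
  have fin: "finite (supp ?t)" using finite_supp_hall_comult[OF fg j'] .
  define A where "A = {p \<in> supp ?t. \<not> type_alpha (class_rep (fst p))}"
  have tensor_delta: "tensor (delta (fst p)) (delta (snd p)) = delta p" for p :: "'a iso_class \<times> 'a iso_class"
    by (auto simp: fun_eq_iff tensor_def delta_def prod_eq_iff)
  have "?t = (\<Sum>p\<in>supp ?t. ?term p)"
    by (simp add: tensor_delta sum_supp_scale_delta[OF fin])
  also have "\<dots> = (\<Sum>p\<in>A. ?term p) + (\<Sum>p\<in>supp ?t - A. ?term p)"
    using sum.subset_diff[OF _ fin, of A ?term] by (simp add: A_def add.commute)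
  finally have decomp: "?t = (\<Sum>p\<in>A. ?term p) + (\<Sum>p\<in>supp ?t - A. ?term p)" .
  have "(\<Sum>p\<in>A. ?term p) \<in> tensor_space J_alpha fin_supp"
    unfolding tensor_space_def
  proof (intro qfun.span_sum qfun.span_scale qfun.span_base)
    fix p assume "p \<in> A"
    then have "\<not> type_alpha (class_rep (fst p))" by (simp add: A_def)
    then have "delta (fst p) \<in> J_alpha" by (rule delta_mem_J_alpha)
    then show "tensor (delta (fst p)) (delta (snd p)) \<in> {tensor f g | f g. f \<in> J_alpha \<and> g \<in> fin_supp}"
      by (intro CollectI exI[of _ "delta (fst p)"] exI[of _ "delta (snd p)"])
        (simp add: delta_fin_supp)
  qed
  moreover have "(\<Sum>p\<in>supp ?t - A. ?term p) \<in> tensor_space fin_supp J_alpha"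
    unfolding tensor_space_def
  proof (intro qfun.span_sum qfun.span_scale qfun.span_base)
    fix p assume p: "p \<in> supp ?t - A"
    \<comment> \<open>Off \<open>A\<close> the first component is of type \<alpha>. Were the second
      one too, so would be the wedge, and \<open>j\<close> would vanish there.\<close>
    have "\<not> type_alpha (class_rep (snd p))"
    proof
      assume "type_alpha (class_rep (snd p))"
      moreover have "type_alpha (class_rep (fst p))" using p by (simp add: A_def)
      ultimately have "j (mod_class (wedge (class_rep (fst p)) (class_rep (snd p)))) = 0"
        by (intro J_alpha_eq_0[OF j] fin_module_wedge class_rep type_alpha_wedge)
      then show False using p by (simp add: supp_def hall_comult_def case_prod_unfold)
    qed
    then have "delta (snd p) \<in> J_alpha" by (rule delta_mem_J_alpha)
    then show "tensor (delta (fst p)) (delta (snd p)) \<in> {tensor f g | f g. f \<in> fin_supp \<and> g \<in> J_alpha}"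
      by (intro CollectI exI[of _ "delta (fst p)"] exI[of _ "delta (snd p)"])
        (simp add: delta_fin_supp)
  qed
  ultimately show ?thesis by (intro CollectI exI conjI) (rule decomp)
qed

lemma hall_antipode_J_alpha:
  fixes j :: "'a::{monoid_mult,mult_zero} iso_class \<Rightarrow> rat"
  assumes fg: "\<exists>G :: 'a set. finite G \<and> monoid_gen G = UNIV" and j: "j \<in> J_alpha"
  shows "hall_antipode j \<in> J_alpha"
proof -
  have "hall_antipode j X = 0" if X: "type_alpha (class_rep X)" for X
  proof -
    have "j (mod_class (graded (class_rep X) C)) = 0" if "C \<in> flags (class_rep X)" for C
      by (intro J_alpha_eq_0[OF j] fin_module_graded class_rep type_alpha_graded X flags_subset[OF that])
    then show ?thesis by (simp add: hall_antipode_def Let_def)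
  qed
  then show ?thesis
    using hall_antipode_fin_supp[OF fg, of j] j by (simp add: J_alpha_eq)
qed

theorem theorem4p1p1:
  assumes "\<exists>G :: 'a::{monoid_mult,mult_zero} set. finite G \<and> monoid_gen G = UNIV"
  shows "hopf_ideal hall_mult hall_unit hall_comult hall_counit
           (J_alpha :: ('a iso_class \<Rightarrow> rat) set)"
  unfolding hopf_ideal_def
proof (intro conjI ballI)
  show "qfun.subspace (J_alpha :: ('a iso_class \<Rightarrow> rat) set)"
    unfolding J_alpha_def by (rule qfun.subspace_span)
  show "(J_alpha :: ('a iso_class \<Rightarrow> rat) set) \<subseteq> fin_supp"
    by (auto simp: J_alpha_eq)
  show "hall_counit j = 0" if "j \<in> J_alpha" for j :: "'a iso_class \<Rightarrow> rat"
    unfolding hall_counit_def by (rule J_alpha_eq_0[OF that fin_module_zero type_alpha_zero])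
  show "\<exists>S. is_antipode hall_mult (hall_unit :: 'a iso_class \<Rightarrow> rat) hall_comult hall_counit S \<and>
      S ` J_alpha \<subseteq> J_alpha"
    using is_antipode_hall_antipode[OF assms] hall_antipode_J_alpha[OF assms] by blast
qed (use J_alpha_ideal[OF assms] J_alpha_coideal[OF assms] in blast)+

end
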